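(* Assume the generic condition: the $N_R$ nonzero eigenvalues $b_1,\dots,b_{N_R}$ of $B$ (counted with multiplicity) are pairwise distinct. Put $b_0=0$, $$d=\min_{0\le i,j\le N_R,\ i\ne j}|b_i-b_j|,\qquad \beta_0=\frac{2\omega_{\max}}{d}.$$ Then the high-loss eigenvalues $\zeta_j(\beta)$, $1\le j\le N_R$, of $A(\beta)$ are meromorphic in $z=\beta^{-1}$ at $z=0$, with expansions all converging in the punctured disc $0<|z|<\beta_0^{-1}$. Their corresponding eigenprojections $P_j(\beta)$, $1\le j\le N_R$, are analytic in $z=\beta^{-1}$ in this disc, with $\dim\operatorname{Ran}P_j(\beta)=1$ for $1\le j\le N_R$; in particular, the high-loss eigenvalues are simple eigenvalues of $A(\beta)$. Moreover, if $\beta>\beta_0$ then $$\operatorname{Re}\zeta_j(\beta)=0,\qquad 1\le j\le N_R .$$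
   Context: Setting. $N\ge 1$; $\alpha,\eta,\theta,R$ are real $N\times N$ matrices with $\alpha^{\mathrm T}=\alpha>0$, $\eta^{\mathrm T}=\eta\ge0$, $\theta^{\mathrm T}=-\theta$, $R^{\mathrm T}=R\ge0$, and $N_R=\operatorname{rank}R>0$. $\sqrt{\cdot}$ denotes the positive semidefinite square root. On $H=\mathbb C^{2N}=\mathbb C^N\oplus\mathbb C^N$ (standard inner product) set $$\Omega=\begin{bmatrix}-2\mathrm i\sqrt\alpha^{-1}\theta\sqrt\alpha^{-1} & -\mathrm i\Phi^{\mathrm T}\\ \mathrm i\Phi&0\end{bmatrix},\quad \Phi=\sqrt\eta\sqrt\alpha^{-1},\quad B=\begin{bmatrix}\sqrt\alpha^{-1}R\sqrt\alpha^{-1}&0\\0&0\end{bmatrix},\quad A(\beta)=\Omega-\mathrm i\beta B$$ ($A(\beta)$ is the system operator, with loss parameter $\beta\ge0$, also considered for complex $\beta$; $\Omega$ is Hermitian, $B\ge0$, $\operatorname{rank}B=N_R$). $\omega_{\max}$ is the largest eigenvalue of $\Omega$ (it equals $\|\Omega\|$); if $\omega_{\max}=0$, read $\beta_0^{-1}=+\infty$. $0<b_1\le\dots\le b_{N_R}$ are the nonzero eigenvalues of $B$ with multiplicity (equivalently of $\alpha^{-1}R$). High-loss eigenvalues (known facts): for $\beta$ sufficiently large, $A(\beta)$ has (counting multiplicities) exactly $N_R$ eigenvalues $\zeta_j(\beta)$, $1\le j\le N_R$, that are unbounded as $\beta\to\infty$; they can be labeled so that each is a convergent Laurent series in $\beta^{-1}$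 with $\zeta_j(\beta)=-\mathrm i b_j\beta+O(1)$ as $\beta\to\infty$. *)

theory Defs
  imports
    "HOL-Complex_Analysis.Complex_Analysis"
    "Jordan_Normal_Form.Char_Poly"
    "Jordan_Normal_Form.Gauss_Jordan_Elimination"
    "Jordan_Normal_Form.Matrix_Kernel"
    "Jordan_Normal_Form.DL_Rank"
begin

definition sym_mat :: "nat \<Rightarrow> real mat \<Rightarrow> bool" where
  "sym_mat N M \<longleftrightarrow> M \<in> carrier_mat N N \<and> transpose_mat M = M"

definition psd_mat :: "nat \<Rightarrow> real mat \<Rightarrow> bool" where
  "psd_mat N M \<longleftrightarrow> sym_mat N M \<and> (\<forall>v\<in>carrier_vec N. 0 \<le> scalar_prod v (M *\<^sub>v v))"

definition pd_mat :: "nat \<Rightarrow> real mat \<Rightarrow> bool" where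
  "pd_mat N M \<longleftrightarrow>
     sym_mat N M \<and> (\<forall>v\<in>carrier_vec N. v \<noteq> 0\<^sub>v N \<longrightarrow> 0 < scalar_prod v (M *\<^sub>v v))"

(* Every positive semidefinite M has exactly one positive semidefinite square root;
   the value is unspecified for other M. *)
definition sqrt_mat :: "real mat \<Rightarrow> real mat" where
  "sqrt_mat M = (THE S. psd_mat (dim_row M) S \<and> S * S = M)"

(* Unspecified unless alpha is positive definite (mat_inverse returns None on singular matrices). *)
definition inv_sqrt_mat :: "real mat \<Rightarrow> real mat" where
  "inv_sqrt_mat \<alpha> = the (mat_inverse (sqrt_mat \<alpha>))"

abbreviation cmat :: "real mat \<Rightarrow> complex mat" where
  "cmat \<equiv> map_mat complex_of_real"

definition Phi_mat :: "real mat \<Rightarrow> real mat \<Rightarrow> real mat" where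
  "Phi_mat \<alpha> \<eta> = sqrt_mat \<eta> * inv_sqrt_mat \<alpha>"

definition Omega_mat :: "real mat \<Rightarrow> real mat \<Rightarrow> real mat \<Rightarrow> complex mat" where
  "Omega_mat \<alpha> \<eta> \<theta> =
     four_block_mat
       ((- 2 * \<i>) \<cdot>\<^sub>m cmat (inv_sqrt_mat \<alpha> * \<theta> * inv_sqrt_mat \<alpha>))
       ((- \<i>) \<cdot>\<^sub>m cmat (transpose_mat (Phi_mat \<alpha> \<eta>)))
       (\<i> \<cdot>\<^sub>m cmat (Phi_mat \<alpha> \<eta>))
       (0\<^sub>m (dim_row \<alpha>) (dim_row \<alpha>))"

definition B_mat :: "real mat \<Rightarrow> real mat \<Rightarrow> complex mat" where
  "B_mat \<alpha> R =
     four_block_mat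
       (cmat (inv_sqrt_mat \<alpha> * R * inv_sqrt_mat \<alpha>))
       (0\<^sub>m (dim_row \<alpha>) (dim_row \<alpha>))
       (0\<^sub>m (dim_row \<alpha>) (dim_row \<alpha>))
       (0\<^sub>m (dim_row \<alpha>) (dim_row \<alpha>))"

definition system_op ::
  "real mat \<Rightarrow> real mat \<Rightarrow> real mat \<Rightarrow> real mat \<Rightarrow> complex \<Rightarrow> complex mat" where
  "system_op \<alpha> \<eta> \<theta> R \<beta> = Omega_mat \<alpha> \<eta> \<theta> - (\<i> * \<beta>) \<cdot>\<^sub>m B_mat \<alpha> R"

definition omega_max :: "real mat \<Rightarrow> real mat \<Rightarrow> real mat \<Rightarrow> real" where
  "omega_max \<alpha> \<eta> \<theta> = Max {\<omega>. eigenvalue (Omega_mat \<alpha> \<eta> \<theta>) (complex_of_real \<omega>)}"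

(* b 1, ..., b m is the nondecreasing list of the nonzero eigenvalues of B, repeated according
   to multiplicity, together with the convention b 0 = 0. *)
definition nonzero_eigenvalues :: "complex mat \<Rightarrow> nat \<Rightarrow> (nat \<Rightarrow> real) \<Rightarrow> bool" where
  "nonzero_eigenvalues B m b \<longleftrightarrow>
     b 0 = 0 \<and> (\<forall>j\<in>{1..m}. 0 < b j) \<and> mono_on {1..m} b \<and>
     char_poly B = (\<Prod>j=1..m. [:- complex_of_real (b j), 1:]) * [:0, 1:] ^ (dim_row B - m)"

definition gap :: "nat \<Rightarrow> (nat \<Rightarrow> real) \<Rightarrow> real" where
  "gap m b = Min {\<bar>b i - b j\<bar> | i j. i \<le> m \<and> j \<le> m \<and> i \<noteq> j}"

definition beta0 ::
  "real mat \<Rightarrow> real mat \<Rightarrow> real mat \<Rightarrow> nat \<Rightarrow> (nat \<Rightarrow> real) \<Rightarrow> real" where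
  "beta0 \<alpha> \<eta> \<theta> m b = 2 * omega_max \<alpha> \<eta> \<theta> / gap m b"

(* zeta 1, ..., zeta m are, for large real beta, the eigenvalues of A(beta) that are unbounded as
   beta tends to infinity: counting multiplicities, all other eigenvalues (the list mus) stay
   bounded by a constant C, while zeta j is a convergent Laurent series in 1/beta with
   zeta j = - i (b j) beta + O(1), so it is unbounded when b j > 0. *)
definition high_loss_eigenvalues ::
  "(complex \<Rightarrow> complex mat) \<Rightarrow> nat \<Rightarrow> (nat \<Rightarrow> real) \<Rightarrow> (nat \<Rightarrow> real \<Rightarrow> complex) \<Rightarrow> bool" where
  "high_loss_eigenvalues A m b \<zeta> \<longleftrightarrow>
     (\<exists>C. \<forall>\<^sub>F \<beta> in at_top. \<exists>\<mu>s.
        char_poly (A (complex_of_real \<beta>)) =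
          (\<Prod>j=1..m. [:- \<zeta> j \<beta>, 1:]) * (\<Prod>\<mu>\<leftarrow>\<mu>s. [:- \<mu>, 1:]) \<and>
        (\<forall>\<mu>\<in>set \<mu>s. cmod \<mu> \<le> C)) \<and>
     (\<forall>j\<in>{1..m}.
        (\<exists>F. fls_conv_radius F > 0 \<and>
             (\<forall>\<^sub>F \<beta> in at_top. \<zeta> j \<beta> = eval_fls F (inverse (complex_of_real \<beta>)))) \<and>
        (\<lambda>\<beta>. \<zeta> j \<beta> - (- \<i> * complex_of_real (b j) * complex_of_real \<beta>)) \<in> O[at_top](\<lambda>_. 1))"

definition alg_eigenspace :: "complex mat \<Rightarrow> complex \<Rightarrow> complex vec set" where
  "alg_eigenspace A \<nu> = (\<Union>k. mat_kernel (char_matrix A \<nu> ^\<^sub>m k))"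

(* P is the projection onto the algebraic (generalized) eigenspace of A for nu along the sum
   of all its other algebraic eigenspaces. The whole space is the direct sum of the algebraic
   eigenspaces, so annihilating the others fixes the kernel of P. *)
definition is_eigenprojection :: "complex mat \<Rightarrow> complex \<Rightarrow> complex mat \<Rightarrow> bool" where
  "is_eigenprojection A \<nu> P \<longleftrightarrow>
     P \<in> carrier_mat (dim_row A) (dim_row A) \<and>
     P * P = P \<and>
     {P *\<^sub>v v | v. v \<in> carrier_vec (dim_row A)} = alg_eigenspace A \<nu> \<and>
     (\<forall>\<mu>. \<mu> \<noteq> \<nu> \<longrightarrow> alg_eigenspace A \<mu> \<subseteq> mat_kernel P)"

end

theory Submission
  imports Defs "Jordan_Normal_Form.Schur_Decomposition"
begin

text \<open>
  Put \<open>z = 1 / \<beta>\<close>, so that \<open>A(\<beta>) = \<beta> M(z)\<close> with \<open>M(z) = z \<Omega> - \<i> B\<close>.  Since \<open>B\<close> and \<open>\<Omega>\<close> are Hermitian,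
  every eigenvalue of \<open>M(z)\<close> lies within \<open>\<bar>z\<bar> \<omega>\<close> of some \<open>- \<i> b\<^sub>k\<close>, \<open>0 \<le> k \<le> N\<^sub>R\<close>, where \<open>\<omega> = \<omega>\<^sub>m\<^sub>a\<^sub>x\<close>;
  for \<open>\<bar>z\<bar> < 1 / \<beta>\<^sub>0\<close> this radius is less than \<open>d / 2\<close>, so no eigenvalue crosses the circle of radius
  \<open>d / 2\<close> about \<open>- \<i> b\<^sub>j\<close>.  The number of eigenvalues inside that circle is a contour integral that is
  holomorphic in \<open>z\<close>, hence constantly its value \<open>1\<close> at \<open>z = 0\<close>, and the corresponding
  first-moment integral is the eigenvalue \<open>\<mu>\<^sub>j(z)\<close> itself.  Then \<open>\<zeta>\<^sub>j(\<beta>) = \<beta> \<mu>\<^sub>j(1 / \<beta>)\<close>, and the eigenprojection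
  is \<open>adj(\<mu>\<^sub>j - M(z)) / \<chi>'(\<mu>\<^sub>j)\<close> for the characteristic polynomial \<open>\<chi>\<close> of \<open>M(z)\<close>.  For real \<open>z\<close> the
  spectrum of \<open>M(z)\<close> is invariant under \<open>x \<mapsto> - cnj x\<close>, which maps the \<open>j\<close>-th disc to itself, so
  \<open>\<mu>\<^sub>j(z)\<close> is imaginary.
\<close>

text \<open>A single scalar polynomial, the characteristic polynomial of M(z) in x with coefficients
  polynomial in z, carries the analysis; the projection comes from the adjugate as a rational
  expression in z and the eigenvalue, so no matrix-valued integral occurs. M(z) is not normal in
  general, but for an eigenvector v the equation z \<Omega> v = (x + i B) v has a normal matrix on
  either side even for complex z; comparing norms in two eigenbases gives the radius |z| \<omega>
  with no further constant. Radius d / 2 is what makes the discs about distinct -i b_k disjoint,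
  hence the factor 2 in beta_0; counting b_0 = 0 in d also separates the bounded eigenvalues from
  the others. Since \<Omega> is purely imaginary, its spectrum is symmetric and its largest
  eigenvalue bounds all of them in modulus. A separate obstacle is that the square roots of \<alpha>
  and \<eta> are given by a definite description: their existence, uniqueness and realness must be
  derived from the spectral theorem before \<Omega> and B are known to be Hermitian.\<close>

unbundle no vec_syntax
no_notation fps_nth (infixl "$" 75)

section \<open>Simple roots of polynomials depending on a parameter\<close>

text \<open>\<open>C\<close> is read as a polynomial in x over the ring of polynomials in z, and z
  is fixed here. Polynomial dependence on both variables gives joint continuity and an explicit
  z-derivative.\<close>

abbreviation specialize :: "complex poly poly \<Rightarrow> complex \<Rightarrow> complex poly" where
  "specialize C z \<equiv> map_poly (\<lambda>q. poly q z) C"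

lemma specialize_pCons: "specialize (pCons a C) z = pCons (poly a z) (specialize C z)"
  by (cases "a = 0 \<and> C = 0") (auto simp: map_poly_pCons)

lemma poly_specialize: "poly (specialize C z) x = (\<Sum>i\<le>degree C. poly (coeff C i) z * x ^ i)"
proof -
  have "poly (specialize C z) x = poly (poly C [:x:]) z"
    by (induction C) (auto simp: specialize_pCons)
  also have "\<dots> = (\<Sum>i\<le>degree C. poly (coeff C i) z * x ^ i)"
    by (subst (1) poly_altdef) (simp add: poly_sum poly_power)
  finally show ?thesis .
qed

lemma pderiv_specialize: "pderiv (specialize C z) = specialize (pderiv C) z"
  by (rule poly_eqI) (simp add: coeff_pderiv coeff_map_poly)

text \<open>Differentiation in the parameter z acts on the coefficients, hence
  \<open>map_poly pderiv C\<close>; the derivative in x is \<open>pderiv C\<close>.\<close>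

lemma DERIV_poly_specialize:
  "((\<lambda>z. poly (specialize C z) x) has_field_derivative poly (specialize (map_poly pderiv C) z) x) (at z within S)"
proof (induction C)
  case 0
  then show ?case by simp
next
  case (pCons a C)
  have "map_poly pderiv (pCons a C) = pCons (pderiv a) (map_poly pderiv C)"
    using pCons.hyps by (simp add: map_poly_pCons)
  moreover have "((\<lambda>z. poly a z + x * poly (specialize C z) x) has_field_derivative
      poly (pderiv a) z + x * poly (specialize (map_poly pderiv C) z) x) (at z within S)"
    by (intro DERIV_add DERIV_cmult pCons.IH DERIV_subset[OF poly_DERIV]) auto
  ultimately show ?case by (simp add: specialize_pCons)
qed

lemma continuous_on_poly_specialize [continuous_intros]:
  assumes "continuous_on S g" "continuous_on S h"
  shows "continuous_on S (\<lambda>t. poly (specialize C (g t)) (h t))"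
  unfolding poly_specialize by (intro continuous_intros assms)

text \<open>Leibniz' rule under the integral sign applies because the denominator has no zero on the
  circle for any parameter in \<open>U\<close>. The weight \<open>h\<close> is later the constant 1
  or the identity.\<close>

lemma holomorphic_contour_integral_specialize:
  assumes U: "convex U" and h: "continuous_on UNIV h"
    and nz: "\<And>z x. z \<in> U \<Longrightarrow> x \<in> sphere c \<rho> \<Longrightarrow> poly (specialize D z) x \<noteq> 0" and \<rho>: "\<rho> > 0"
  shows "(\<lambda>z. contour_integral (circlepath c \<rho>)
            (\<lambda>x. h x * poly (specialize C z) x / poly (specialize D z) x)) holomorphic_on U"
proof -
  let ?\<gamma> = "circlepath c \<rho>"
  \<comment> \<open>The velocity of the circle path; \<open>F'\<close> below is the quotient rule
    for \<open>F\<close> in z.\<close>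
  let ?vd = "\<lambda>t. 2 * of_real pi * \<i> * \<rho> * exp (2 * of_real pi * \<i> * of_real t)"
  define F where "F z t = h (?\<gamma> t) * (poly (specialize C z) (?\<gamma> t) / poly (specialize D z) (?\<gamma> t)) * ?vd t"
    for z and t :: real
  define F' where "F' z t = h (?\<gamma> t) *
     ((poly (specialize (map_poly pderiv C) z) (?\<gamma> t) * poly (specialize D z) (?\<gamma> t) -
      poly (specialize C z) (?\<gamma> t) * poly (specialize (map_poly pderiv D) z) (?\<gamma> t)) /
      (poly (specialize D z) (?\<gamma> t) * poly (specialize D z) (?\<gamma> t))) * ?vd t" for z and t :: real
  have \<gamma>: "?\<gamma> t \<in> sphere c \<rho>" if "t \<in> {0..1}" for t
  proof -
    have "path_image ?\<gamma> = sphere c \<rho>" using \<rho> by simp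
    then show ?thesis using that unfolding path_image_def by blast
  qed
  have nz': "poly (specialize D z) (?\<gamma> t) \<noteq> 0" if "z \<in> U" "t \<in> {0..1}" for z t
    using nz[OF that(1) \<gamma>[OF that(2)]] .
  have c\<gamma>: "continuous_on S ?\<gamma>" for S by (auto simp: circlepath intro!: continuous_intros)
  have ch: "continuous_on S g \<Longrightarrow> continuous_on S (\<lambda>t. h (g t))" for S and g :: "'b::topological_space \<Rightarrow> complex"
    using continuous_on_compose2[OF h] by auto
  have "(\<lambda>z. integral (cbox 0 1) (F z)) holomorphic_on U"
  proof (rule leibniz_rule_holomorphic[where fx = F'])
    show "((\<lambda>z. F z t) has_field_derivative F' z t) (at z within U)" if "z \<in> U" "t \<in> cbox 0 1" for z t
      unfolding F_def F'_def using nz'[of z t] that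
      by (intro DERIV_cmult_right DERIV_cmult DERIV_divide DERIV_poly_specialize) auto
    show "F z integrable_on cbox 0 1" if "z \<in> U" for z
      unfolding F_def using nz'[OF that]
      by (intro integrable_continuous continuous_intros c\<gamma> ch) auto
    have "continuous_on (U \<times> {0..1}) (\<lambda>p. F' (fst p) (snd p))"
      unfolding F'_def
      by (intro continuous_intros ch continuous_on_compose2[OF c\<gamma>[of UNIV]]) (auto simp: nz')
    then show "continuous_on (U \<times> cbox 0 1) (\<lambda>(z, t). F' z t)"
      by (simp add: case_prod_unfold)
  qed (rule U)
  moreover have "integral (cbox 0 1) (F z) = contour_integral ?\<gamma>
            (\<lambda>x. h x * poly (specialize C z) x / poly (specialize D z) x)" for z
    unfolding contour_integral_integral F_def
    by (auto intro!: Henstock_Kurzweil_Integration.integral_cong simp: vector_derivative_circlepath)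
  ultimately show ?thesis by simp
qed

lemma poly_prod_linear_eq_0_iff:
  fixes as :: "complex list"
  shows "poly (\<Prod>a\<leftarrow>as. [:- a, 1:]) x = 0 \<longleftrightarrow> x \<in> set as"
  by (induction as) auto

text \<open>The logarithmic derivative is the sum of 1 / (x - a) over the roots, so a root inside
  the circle contributes h(a) by Cauchy's formula and a root outside contributes 0. Listing the
  roots with repetition builds multiplicity in.\<close>

lemma contour_integral_log_deriv:
  fixes as :: "complex list"
  defines "p \<equiv> \<Prod>a\<leftarrow>as. [:- a, 1:]"
  assumes h: "h holomorphic_on UNIV" and \<rho>: "\<rho> > 0"
    and nz: "\<And>x. x \<in> sphere c \<rho> \<Longrightarrow> poly p x \<noteq> 0"
  shows "((\<lambda>x. h x * poly (pderiv p) x / poly p x) has_contour_integral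
           2 * of_real pi * \<i> * (\<Sum>a\<leftarrow>filter (\<lambda>a. a \<in> ball c \<rho>) as. h a)) (circlepath c \<rho>)"
  using nz unfolding p_def
proof (induction as)
  case Nil
  then show ?case by (simp add: has_contour_integral_0)
next
  case (Cons a as)
  let ?q = "\<Prod>a\<leftarrow>as. [:- a, 1:]"
  have nzq: "poly ?q x \<noteq> 0" and xa: "x \<noteq> a" if "x \<in> sphere c \<rho>" for x
    using Cons.prems[OF that] by auto
  have 1: "((\<lambda>x. h x / (x - a)) has_contour_integral
        2 * of_real pi * \<i> * (if a \<in> ball c \<rho> then h a else 0)) (circlepath c \<rho>)"
  proof (cases "a \<in> ball c \<rho>")
    case True
    then show ?thesis
      using Cauchy_integral_circlepath_simple[of h c \<rho> a] holomorphic_on_subset[OF h]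
      by (auto simp: dist_norm norm_minus_commute)
  next
    case False
    then have "a \<notin> cball c \<rho>" using xa[of a] by auto
    then have "(\<lambda>x. h x / (x - a)) holomorphic_on cball c \<rho>"
      by (intro holomorphic_intros holomorphic_on_subset[OF h]) auto
    then have "((\<lambda>x. h x / (x - a)) has_contour_integral 0) (circlepath c \<rho>)"
      using \<rho> by (intro Cauchy_theorem_convex_simple[of _ "cball c \<rho>"]) auto
    with False show ?thesis by simp
  qed
  have "((\<lambda>x. h x / (x - a) + h x * poly (pderiv ?q) x / poly ?q x) has_contour_integral
     2 * of_real pi * \<i> * (if a \<in> ball c \<rho> then h a else 0) +
     2 * of_real pi * \<i> * (\<Sum>a\<leftarrow>filter (\<lambda>a. a \<in> ball c \<rho>) as. h a)) (circlepath c \<rho>)"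
    by (intro has_contour_integral_add 1 Cons.IH nzq)
  then have "((\<lambda>x. h x / (x - a) + h x * poly (pderiv ?q) x / poly ?q x) has_contour_integral
     2 * of_real pi * \<i> * (\<Sum>a\<leftarrow>filter (\<lambda>a. a \<in> ball c \<rho>) (a # as). h a)) (circlepath c \<rho>)"
    by (cases "a \<in> ball c \<rho>") (simp_all add: algebra_simps)
  then show ?case
  proof (rule has_contour_integral_eq)
    fix x assume "x \<in> path_image (circlepath c \<rho>)"
    then have x: "x \<in> sphere c \<rho>" using \<rho> by simp
    show "h x / (x - a) + h x * poly (pderiv ?q) x / poly ?q x =
      h x * poly (pderiv (\<Prod>a\<leftarrow>a # as. [:- a, 1:])) x / poly (\<Prod>a\<leftarrow>a # as. [:- a, 1:]) x"
    proof -
      have "poly (pderiv (\<Prod>a\<leftarrow>a # as. [:- a, 1:])) x = poly ?q x + (x - a) * poly (pderiv ?q) x"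
        by (simp only: list.map prod_list.Cons pderiv_mult) (simp add: pderiv_pCons algebra_simps)
      moreover have "poly (\<Prod>a\<leftarrow>a # as. [:- a, 1:]) x = (x - a) * poly ?q x"
        by (simp only: list.map prod_list.Cons) (simp add: algebra_simps)
      ultimately show ?thesis using nzq[OF x] xa[OF x] by (simp only:) (simp add: field_simps)
    qed
  qed
qed

text \<open>Encodes "exactly one root in \<open>S\<close>, counted with multiplicity" without
  reference to a chosen factorization.\<close>

definition simple_root_in :: "complex poly \<Rightarrow> complex set \<Rightarrow> complex \<Rightarrow> bool" where
  "simple_root_in p S w \<longleftrightarrow> w \<in> S \<and> poly p w = 0 \<and> poly (pderiv p) w \<noteq> 0 \<and>
     (\<forall>x\<in>S. poly p x = 0 \<longrightarrow> x = w)"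

text \<open>The link to the counting integral: with weight 1 that integral is the length of the
  filtered root list.\<close>

lemma simple_root_in_prod_linear_iff:
  fixes as :: "complex list"
  shows "simple_root_in (\<Prod>a\<leftarrow>as. [:- a, 1:]) S w \<longleftrightarrow> filter (\<lambda>a. a \<in> S) as = [w]"
proof -
  \<comment> \<open>In the product rule at w only the term survives in which the factor x - w is
    differentiated, leaving the product of the remaining factors.\<close>
  have split: "poly (pderiv (\<Prod>a\<leftarrow>xs @ w # ys. [:- a, 1:])) w \<noteq> 0 \<longleftrightarrow> w \<notin> set xs \<union> set ys" for xs ys
  proof -
    have "(\<Prod>a\<leftarrow>xs @ w # ys. [:- a, 1:]) = [:- w, 1:] * (\<Prod>a\<leftarrow>xs @ ys. [:- a, 1:])"
      by (simp only: map_append list.map prod_list.append prod_list.Cons mult.left_commute)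
    then have "poly (pderiv (\<Prod>a\<leftarrow>xs @ w # ys. [:- a, 1:])) w = poly (\<Prod>a\<leftarrow>xs @ ys. [:- a, 1:]) w"
      by (simp only: pderiv_mult) (simp add: pderiv_pCons)
    then show ?thesis by (simp only: poly_prod_linear_eq_0_iff) auto
  qed
  show ?thesis
  proof
    assume w: "simple_root_in (\<Prod>a\<leftarrow>as. [:- a, 1:]) S w"
    then have "w \<in> set as" by (auto simp: simple_root_in_def poly_prod_linear_eq_0_iff)
    then obtain xs ys where as: "as = xs @ w # ys" by (meson split_list)
    have nw: "w \<notin> set xs \<union> set ys" and wS: "w \<in> S"
      using w split[of xs ys] unfolding simple_root_in_def as by blast+
    have "u \<notin> S" if u: "u \<in> set xs \<union> set ys" for u
    proof
      assume "u \<in> S"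
      moreover have "u \<in> set as" using u as by auto
      ultimately have "u = w" using w unfolding simple_root_in_def poly_prod_linear_eq_0_iff by blast
      then show False using nw u by blast
    qed
    then have "filter (\<lambda>a. a \<in> S) xs = []" "filter (\<lambda>a. a \<in> S) ys = []"
      by (auto simp: filter_empty_conv)
    then show "filter (\<lambda>a. a \<in> S) as = [w]" using wS by (simp add: as)
  next
    assume f: "filter (\<lambda>a. a \<in> S) as = [w]"
    then obtain xs ys where as: "as = xs @ w # ys" and "\<forall>u\<in>set xs. u \<notin> S" "w \<in> S" "filter (\<lambda>a. a \<in> S) ys = []"
      by (auto simp: filter_eq_Cons_iff)
    then have *: "\<forall>u\<in>set xs \<union> set ys. u \<notin> S" by (auto simp: filter_empty_conv)
    then have "poly (pderiv (\<Prod>a\<leftarrow>as. [:- a, 1:])) w \<noteq> 0" using split[of xs ys] \<open>w \<in> S\<close> as by auto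
    then show "simple_root_in (\<Prod>a\<leftarrow>as. [:- a, 1:]) S w"
      using * \<open>w \<in> S\<close> by (auto simp: simple_root_in_def poly_prod_linear_eq_0_iff as)
  qed
qed

lemma monic_complex_poly_factorized:
  fixes p :: "complex poly" assumes "monic p"
  obtains as where "p = (\<Prod>a\<leftarrow>as. [:- a, 1:])"
  using fundamental_theorem_algebra_factorized[of p] assms by auto

theorem holomorphic_simple_root:
  assumes U: "open U" "convex U" "z0 \<in> U" and \<rho>: "\<rho> > 0"
    and monic: "\<And>z. monic (specialize C z)"
    and nz: "\<And>z x. z \<in> U \<Longrightarrow> x \<in> sphere c \<rho> \<Longrightarrow> poly (specialize C z) x \<noteq> 0"
    and w0: "simple_root_in (specialize C z0) (ball c \<rho>) w0"
  obtains \<mu> where "\<mu> holomorphic_on U" "\<And>z. z \<in> U \<Longrightarrow> simple_root_in (specialize C z) (ball c \<rho>) (\<mu> z)"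
proof -
  \<comment> \<open>Weight 1 counts the roots inside the circle, and the identity as weight adds
    them up.\<close>
  define G where "G h z = contour_integral (circlepath c \<rho>)
      (\<lambda>x. h x * poly (specialize (pderiv C) z) x / poly (specialize C z) x) / (2 * of_real pi * \<i>)"
    for h :: "complex \<Rightarrow> complex" and z
  have G: "G h z = (\<Sum>a\<leftarrow>filter (\<lambda>a. a \<in> ball c \<rho>) as. h a)"
    if "specialize C z = (\<Prod>a\<leftarrow>as. [:- a, 1:])" "z \<in> U" "h holomorphic_on UNIV" for h z as
    using contour_integral_unique[OF contour_integral_log_deriv[OF that(3) \<rho>, of c as]] nz[OF that(2)]
    unfolding G_def pderiv_specialize[symmetric] that(1) by simp
  have G_hol: "G h holomorphic_on U" if "h holomorphic_on UNIV" for h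
    unfolding G_def using that \<rho> nz holomorphic_on_imp_continuous_on
    by (intro holomorphic_intros holomorphic_contour_integral_specialize U) auto
  have count: "\<exists>n. G (\<lambda>_. 1) z = of_nat n" if "z \<in> U" for z
  proof -
    obtain as where "specialize C z = (\<Prod>a\<leftarrow>as. [:- a, 1:])"
      using monic_complex_poly_factorized[OF monic] .
    from G[OF this that, of "\<lambda>_. 1"] show ?thesis by (auto simp: sum_list_triv)
  qed
  \<comment> \<open>The values are natural numbers, so different values are at least 1 apart;
    continuity on a connected set then forces constancy.\<close>
  have "G (\<lambda>_. 1) constant_on U"
  proof (rule continuous_discrete_range_constant)
    show "connected U" using U by (simp add: convex_connected)
    show "continuous_on U (G (\<lambda>_. 1))" using G_hol by (intro holomorphic_on_imp_continuous_on) auto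
    fix x assume x: "x \<in> U"
    show "\<exists>e>0. \<forall>y. y \<in> U \<and> G (\<lambda>_. 1) y \<noteq> G (\<lambda>_. 1) x \<longrightarrow> e \<le> norm (G (\<lambda>_. 1) y - G (\<lambda>_. 1) x)"
    proof (intro exI[of _ 1] conjI allI impI)
      fix y assume y: "y \<in> U \<and> G (\<lambda>_. 1) y \<noteq> G (\<lambda>_. 1) x"
      then obtain m n where mn: "G (\<lambda>_. 1) y = of_nat m" "G (\<lambda>_. 1) x = of_nat n" using count x by meson
      then have "int m - int n \<noteq> 0" using y by auto
      then have "1 \<le> \<bar>int m - int n\<bar>" by linarith
      then have "1 \<le> cmod (of_int (int m - int n))" unfolding norm_of_int by linarith
      then show "1 \<le> norm (G (\<lambda>_. 1) y - G (\<lambda>_. 1) x)" by (simp add: mn)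
    qed simp
  qed
  moreover have "G (\<lambda>_. 1) z0 = 1"
  proof -
    obtain as where as: "specialize C z0 = (\<Prod>a\<leftarrow>as. [:- a, 1:])"
      using monic_complex_poly_factorized[OF monic] .
    with w0 have "filter (\<lambda>a. a \<in> ball c \<rho>) as = [w0]" by (simp add: simple_root_in_prod_linear_iff)
    then show ?thesis using G[OF as U(3), of "\<lambda>_. 1"] by simp
  qed
  ultimately have one: "G (\<lambda>_. 1) z = 1" if "z \<in> U" for z
    using that U(3) by (metis constant_on_def)
  show thesis
  proof (rule that[of "G (\<lambda>x. x)"])
    show "G (\<lambda>x. x) holomorphic_on U" by (rule G_hol) (auto intro: holomorphic_intros)
    fix z assume z: "z \<in> U"
    obtain as where as: "specialize C z = (\<Prod>a\<leftarrow>as. [:- a, 1:])"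
      using monic_complex_poly_factorized[OF monic] .
    have "of_nat (length (filter (\<lambda>a. a \<in> ball c \<rho>) as)) = (1 :: complex)"
      using one[OF z] G[OF as z, of "\<lambda>_. 1"] by (simp add: sum_list_triv)
    then have "length (filter (\<lambda>a. a \<in> ball c \<rho>) as) = 1"
      by (metis of_nat_1 of_nat_eq_iff)
    then obtain w where w: "filter (\<lambda>a. a \<in> ball c \<rho>) as = [w]"
      by (auto simp: length_Suc_conv)
    then have "G (\<lambda>x. x) z = w" using G[OF as z, of "\<lambda>x. x"] by (simp add: holomorphic_on_id[unfolded id_def])
    then show "simple_root_in (specialize C z) (ball c \<rho>) (G (\<lambda>x. x) z)"
      using w by (simp add: as simple_root_in_prod_linear_iff)
  qed
qed

section \<open>Eigenprojections of simple eigenvalues\<close>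

lemma det_holomorphic:
  fixes M :: "complex \<Rightarrow> complex mat"
  assumes M: "\<And>z. M z \<in> carrier_mat n n"
    and hol: "\<And>i j. i < n \<Longrightarrow> j < n \<Longrightarrow> (\<lambda>z. M z $$ (i, j)) holomorphic_on S"
  shows "(\<lambda>z. det (M z)) holomorphic_on S"
proof -
  have "(\<lambda>z. \<Sum>p\<in>{p. p permutes {0..<n}}. signof p * (\<Prod>i = 0..<n. M z $$ (i, p i))) holomorphic_on S"
    by (intro holomorphic_intros hol) (auto dest: permutes_in_image)
  moreover have "(\<lambda>z. det (M z)) = (\<lambda>z. \<Sum>p\<in>{p. p permutes {0..<n}}. signof p * (\<Prod>i = 0..<n. M z $$ (i, p i)))"
    using det_def'[OF M] by presburger
  ultimately show ?thesis by simp
qed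

lemma adj_mat_holomorphic:
  fixes M :: "complex \<Rightarrow> complex mat"
  assumes M: "\<And>z. M z \<in> carrier_mat n n"
    and hol: "\<And>i j. i < n \<Longrightarrow> j < n \<Longrightarrow> (\<lambda>z. M z $$ (i, j)) holomorphic_on S"
    and ij: "i < n" "j < n"
  shows "(\<lambda>z. adj_mat (M z) $$ (i, j)) holomorphic_on S"
proof -
  have dims: "dim_row (M z) = n" "dim_col (M z) = n" for z using M by auto
  have "(\<lambda>z. det (mat_delete (M z) j i)) holomorphic_on S"
  proof (rule det_holomorphic)
    show "mat_delete (M z) j i \<in> carrier_mat (n - 1) (n - 1)" for z
      using mat_delete_carrier[OF M] .
    show "(\<lambda>z. mat_delete (M z) j i $$ (k, l)) holomorphic_on S" if "k < n - 1" "l < n - 1" for k l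
      using that ij by (auto simp: mat_delete_def dims intro!: hol)
  qed
  then have "(\<lambda>z. (-1) ^ (j + i) * det (mat_delete (M z) j i)) holomorphic_on S"
    by (intro holomorphic_intros)
  then show ?thesis using ij by (simp add: adj_mat_def cofactor_def dims)
qed

text \<open>Adding 1 to the entry (l, k) of X changes the determinant by the cofactor of that entry,
  which is the entry (k, l) of the adjugate. A nonzero kernel vector x with x_k = 0 would be killed
  by both matrices, so both determinants and hence the cofactor would vanish. Thus coordinate k
  determines a kernel vector.\<close>

lemma adj_mat_kernel_unique:
  fixes X :: "complex mat"
  assumes X: "X \<in> carrier_mat n n" and kl: "k < n" "l < n" and nz: "adj_mat X $$ (k, l) \<noteq> 0"
    and x: "x \<in> carrier_vec n" "X *\<^sub>v x = 0\<^sub>v n" "x $ k = 0"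
  shows "x = 0\<^sub>v n"
proof (rule ccontr)
  assume x0: "x \<noteq> 0\<^sub>v n"
  define Y where "Y = mat n n (\<lambda>(i, j). X $$ (i, j) + (if i = l \<and> j = k then 1 else 0))"
  have Y: "Y \<in> carrier_mat n n" by (simp add: Y_def)
  have "Y *\<^sub>v x = 0\<^sub>v n"
  proof (rule eq_vecI)
    fix i assume "i < dim_vec (0\<^sub>v n :: complex vec)"
    then have i: "i < n" by simp
    have "(Y *\<^sub>v x) $ i = (\<Sum>j = 0..<n. X $$ (i, j) * x $ j) + (\<Sum>j = 0..<n. (if i = l \<and> j = k then 1 else 0) * x $ j)"
      using i x(1) by (simp add: Y_def scalar_prod_def algebra_simps sum.distrib)
    also have "(\<Sum>j = 0..<n. (if i = l \<and> j = k then 1 else 0) * x $ j) = 0"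
      using x(3) by (intro sum.neutral) auto
    also have "(\<Sum>j = 0..<n. X $$ (i, j) * x $ j) = (X *\<^sub>v x) $ i"
      using i x(1) X by (simp add: scalar_prod_def)
    finally show "(Y *\<^sub>v x) $ i = 0\<^sub>v n $ i" using x(2) i by simp
  qed (use Y in auto)
  then have "det Y = 0" "det X = 0"
    using x0 x X Y det_0_iff_vec_prod_zero by blast+
  \<comment> \<open>Cofactors along row l ignore that row, the only one in which \<open>Y\<close>
    differs from \<open>X\<close>.\<close>
  have "cofactor Y l j = cofactor X l j" for j
    unfolding cofactor_def using X kl
    by (auto simp: mat_delete_def Y_def intro!: arg_cong[of _ _ det] eq_matI)
  then have "det Y = (\<Sum>j<n. Y $$ (l, j) * cofactor X l j)"
    using laplace_expansion_row[OF Y kl(2)] by simp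
  also have "\<dots> = (\<Sum>j<n. X $$ (l, j) * cofactor X l j + (if j = k then cofactor X l j else 0))"
    using kl by (intro sum.cong) (auto simp: Y_def algebra_simps)
  also have "\<dots> = det X + cofactor X l k"
    using laplace_expansion_row[OF X kl(2)] kl by (simp add: sum.distrib)
  finally have "cofactor X l k = 0" using \<open>det Y = 0\<close> \<open>det X = 0\<close> by simp
  then show False using nz kl X by (simp add: adj_mat_def)
qed

lemma smult_mat_mult_vec:
  fixes P :: "complex mat"
  assumes "P \<in> carrier_mat n m" "v \<in> carrier_vec m"
  shows "(c \<cdot>\<^sub>m P) *\<^sub>v v = c \<cdot>\<^sub>v (P *\<^sub>v v)"
  using assms by (intro eq_vecI) (auto simp: scalar_prod_def sum_distrib_left mult.assoc)

lemma char_matrix_mult_vec: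
  fixes A :: "complex mat"
  assumes A: "A \<in> carrier_mat n n" and v: "v \<in> carrier_vec n"
  shows "char_matrix A y *\<^sub>v v = A *\<^sub>v v - y \<cdot>\<^sub>v v"
  unfolding char_matrix_def using A v
  by (intro eq_vecI) (auto simp: add_scalar_prod_distrib[of _ n] scalar_prod_smult_left)

text \<open>Here \<open>- char_matrix A y\<close> is y - A. Write the characteristic polynomial chi
  as (y - nu) q(y). For y distinct from nu, applying adj(y - A) (y - A) = chi(y) to v and cancelling
  y - nu gives adj(y - A) v = q(y) v. In the limit y to nu the factor is q(nu), which is
  chi'(nu).\<close>

lemma adj_mat_mult_eigenvector:
  fixes A :: "complex mat"
  assumes A: "A \<in> carrier_mat n n" and v: "v \<in> carrier_vec n" "A *\<^sub>v v = \<nu> \<cdot>\<^sub>v v"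
  shows "adj_mat (- char_matrix A \<nu>) *\<^sub>v v = poly (pderiv (char_poly A)) \<nu> \<cdot>\<^sub>v v"
proof (cases "v = 0\<^sub>v n")
  case True
  have "adj_mat (- char_matrix A \<nu>) \<in> carrier_mat n n" using A by (intro adj_mat) auto
  with True show ?thesis by auto
next
  case v0: False
  let ?X = "\<lambda>y. - char_matrix A y"
  have X: "?X y \<in> carrier_mat n n" for y using A by auto
  have aX: "adj_mat (?X y) \<in> carrier_mat n n" for y using adj_mat(1)[OF X] .
  have "eigenvalue A \<nu>" using A v v0 by (auto simp: eigenvalue_def eigenvector_def)
  then have "poly (char_poly A) \<nu> = 0" by (simp add: eigenvalue_root_char_poly[OF A])
  then obtain q where q: "char_poly A = [:- \<nu>, 1:] * q" by (auto simp: poly_eq_0_iff_dvd)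
  have q\<nu>: "poly (pderiv (char_poly A)) \<nu> = poly q \<nu>" unfolding q pderiv_mult by (simp add: pderiv_pCons)
  have eq: "(adj_mat (?X y) *\<^sub>v v) $ i = poly q y * v $ i" if "y \<noteq> \<nu>" "i < n" for y i
  proof -
    have "?X y *\<^sub>v v = (y - \<nu>) \<cdot>\<^sub>v v"
    proof -
      have "dim_vec v = dim_col (char_matrix A y)" using A v by (simp add: char_matrix_def)
      then show ?thesis using A v
        by (simp add: uminus_mult_mat_vec) (intro eq_vecI, auto simp: char_matrix_mult_vec[OF A v(1)] algebra_simps)
    qed
    then have "(y - \<nu>) \<cdot>\<^sub>v (adj_mat (?X y) *\<^sub>v v) = adj_mat (?X y) *\<^sub>v (?X y *\<^sub>v v)"
      using mult_mat_vec[OF aX v(1)] by simp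
    also have "\<dots> = (adj_mat (?X y) * ?X y) *\<^sub>v v"
      using assoc_mult_mat_vec[OF aX X v(1)] by simp
    also have "\<dots> = poly (char_poly A) y \<cdot>\<^sub>v v"
      unfolding adj_mat(3)[OF X] char_poly_matrix[OF A] using v by auto
    finally have "((y - \<nu>) \<cdot>\<^sub>v (adj_mat (?X y) *\<^sub>v v)) $ i = (poly (char_poly A) y \<cdot>\<^sub>v v) $ i" by simp
    then have "(y - \<nu>) * (adj_mat (?X y) *\<^sub>v v) $ i = (y - \<nu>) * (poly q y * v $ i)"
      using v that aX[of y] by (simp add: q algebra_simps)
    then show ?thesis using that by simp
  qed
  show ?thesis
  proof (rule eq_vecI)
    fix i assume "i < dim_vec (poly (pderiv (char_poly A)) \<nu> \<cdot>\<^sub>v v)"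
    then have i: "i < n" using v by simp
    have Xhol: "(\<lambda>y. ?X y $$ (k, l)) holomorphic_on UNIV" if "k < n" "l < n" for k l
      using that A by (auto simp: char_matrix_def intro!: holomorphic_intros)
    have "(\<lambda>y. \<Sum>j = 0..<n. adj_mat (?X y) $$ (i, j) * v $ j) holomorphic_on UNIV"
      using i by (intro holomorphic_intros adj_mat_holomorphic[OF X] Xhol) auto
    moreover have "(\<lambda>y. (adj_mat (?X y) *\<^sub>v v) $ i) = (\<lambda>y. \<Sum>j = 0..<n. adj_mat (?X y) $$ (i, j) * v $ j)"
    proof
      fix y
      have "dim_row (adj_mat (?X y)) = n" "dim_col (adj_mat (?X y)) = n" using aX[of y] by auto
      then show "(adj_mat (?X y) *\<^sub>v v) $ i = (\<Sum>j = 0..<n. adj_mat (?X y) $$ (i, j) * v $ j)"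
        using i v by (simp add: scalar_prod_def)
    qed
    \<comment> \<open>Continuity of the adjugate in y fills in the point y = nu, which the
      cancellation excludes.\<close>
    ultimately have "isCont (\<lambda>y. (adj_mat (?X y) *\<^sub>v v) $ i) \<nu>"
      by (metis UNIV_I continuous_on_eq_continuous_at holomorphic_on_imp_continuous_on open_UNIV)
    then have "((\<lambda>y. (adj_mat (?X y) *\<^sub>v v) $ i) \<longlongrightarrow> (adj_mat (?X \<nu>) *\<^sub>v v) $ i) (at \<nu>)"
      by (simp add: isCont_def)
    moreover have "((\<lambda>y. (adj_mat (?X y) *\<^sub>v v) $ i) \<longlongrightarrow> poly q \<nu> * v $ i) (at \<nu>)"
    proof (rule Lim_transform_eventually)
      show "((\<lambda>y. poly q y * v $ i) \<longlongrightarrow> poly q \<nu> * v $ i) (at \<nu>)"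
        by (intro tendsto_intros)
      show "\<forall>\<^sub>F y in at \<nu>. poly q y * v $ i = (adj_mat (?X y) *\<^sub>v v) $ i"
        using eq i by (auto simp: eventually_at_filter)
    qed
    ultimately have "(adj_mat (?X \<nu>) *\<^sub>v v) $ i = poly q \<nu> * v $ i"
      by (rule tendsto_unique[rotated]) auto
    then show "(adj_mat (?X \<nu>) *\<^sub>v v) $ i = (poly (pderiv (char_poly A)) \<nu> \<cdot>\<^sub>v v) $ i"
      using i v by (simp add: q\<nu>)
  qed (use aX v in auto)
qed

text \<open>The two product identities together with fixing eigenvectors exclude Jordan chains of
  length 2 at nu and force P to vanish on every other generalized eigenspace.\<close>

lemma is_eigenprojectionI:
  fixes A P :: "complex mat"
  assumes A: "A \<in> carrier_mat n n" and P: "P \<in> carrier_mat n n"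
    and AP: "A * P = \<nu> \<cdot>\<^sub>m P" and PA: "P * A = \<nu> \<cdot>\<^sub>m P"
    and fixed: "\<And>v. v \<in> carrier_vec n \<Longrightarrow> A *\<^sub>v v = \<nu> \<cdot>\<^sub>v v \<Longrightarrow> P *\<^sub>v v = v"
  shows "is_eigenprojection A \<nu> P"
proof -
  have C: "char_matrix A \<mu> \<in> carrier_mat n n" for \<mu> using A by simp
  have Ck: "char_matrix A \<mu> ^\<^sub>m k \<in> carrier_mat n n" for \<mu> k using C by (rule pow_carrier_mat)
  have APv: "A *\<^sub>v (P *\<^sub>v v) = \<nu> \<cdot>\<^sub>v (P *\<^sub>v v)" if "v \<in> carrier_vec n" for v
    using assoc_mult_mat_vec[OF A P that] smult_mat_mult_vec[OF P that] by (simp add: AP)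
  have PCv: "P *\<^sub>v (char_matrix A \<mu> *\<^sub>v v) = (\<nu> - \<mu>) \<cdot>\<^sub>v (P *\<^sub>v v)" if v: "v \<in> carrier_vec n" for v \<mu>
  proof -
    have "P *\<^sub>v (char_matrix A \<mu> *\<^sub>v v) = P *\<^sub>v (A *\<^sub>v v) - \<mu> \<cdot>\<^sub>v (P *\<^sub>v v)"
      using A P v by (simp add: char_matrix_mult_vec mult_minus_distrib_mat_vec mult_mat_vec)
    also have "P *\<^sub>v (A *\<^sub>v v) = \<nu> \<cdot>\<^sub>v (P *\<^sub>v v)"
      using assoc_mult_mat_vec[OF P A v] smult_mat_mult_vec[OF P v] by (simp add: PA)
    finally show ?thesis using P v by (auto simp: algebra_simps)
  qed
  have ker: "char_matrix A \<nu> *\<^sub>v v = 0\<^sub>v n \<longleftrightarrow> A *\<^sub>v v = \<nu> \<cdot>\<^sub>v v" if "v \<in> carrier_vec n" for v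
    using that A by (auto simp: char_matrix_mult_vec vec_eq_iff)
  \<comment> \<open>If w = (A - nu) v lies in the eigenspace, then P w = w, yet P w = P (A - nu) v =
    0; hence w = 0.\<close>
  have gen: "char_matrix A \<nu> *\<^sub>v v = 0\<^sub>v n"
    if "v \<in> carrier_vec n" "(char_matrix A \<nu> ^\<^sub>m k) *\<^sub>v v = 0\<^sub>v n" for v k
    using that
  proof (induction k arbitrary: v)
    case 0
    then have "v = 0\<^sub>v n" using A by (simp add: char_matrix_def)
    then show ?case using C[of \<nu>] by auto
  next
    case (Suc k)
    let ?w = "char_matrix A \<nu> *\<^sub>v v"
    have w: "?w \<in> carrier_vec n" using mult_mat_vec_carrier[OF C Suc.prems(1)] .
    have "(char_matrix A \<nu> ^\<^sub>m k) *\<^sub>v ?w = 0\<^sub>v n"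
      using Suc.prems assoc_mult_mat_vec[OF Ck C Suc.prems(1)] by simp
    from Suc.IH[OF w this] have "P *\<^sub>v ?w = ?w" using ker[OF w] fixed[OF w] by simp
    moreover have "P *\<^sub>v ?w = 0\<^sub>v n" using PCv[OF Suc.prems(1), of \<nu>] P Suc.prems by auto
    ultimately show ?case by simp
  qed
  have space: "alg_eigenspace A \<nu> = {v \<in> carrier_vec n. A *\<^sub>v v = \<nu> \<cdot>\<^sub>v v}"
  proof (intro equalityI subsetI)
    fix v assume "v \<in> alg_eigenspace A \<nu>"
    then obtain k where "v \<in> mat_kernel (char_matrix A \<nu> ^\<^sub>m k)" by (auto simp: alg_eigenspace_def)
    then have "v \<in> carrier_vec n" "(char_matrix A \<nu> ^\<^sub>m k) *\<^sub>v v = 0\<^sub>v n"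
      using mat_kernel[OF Ck] by auto
    then show "v \<in> {v \<in> carrier_vec n. A *\<^sub>v v = \<nu> \<cdot>\<^sub>v v}" using gen ker by blast
  next
    fix v assume v: "v \<in> {v \<in> carrier_vec n. A *\<^sub>v v = \<nu> \<cdot>\<^sub>v v}"
    then have "v \<in> mat_kernel (char_matrix A \<nu> ^\<^sub>m 1)"
      using mat_kernel[OF Ck, of \<nu> 1] ker C[of \<nu>] by auto
    then show "v \<in> alg_eigenspace A \<nu>" unfolding alg_eigenspace_def by blast
  qed
  have "P * P = P"
  proof (rule mat_col_eqI)
    fix j assume "j < dim_col P"
    then have j: "j < n" using P by simp
    have "A *\<^sub>v col P j = \<nu> \<cdot>\<^sub>v col P j"
      using col_mult2[OF A P j] j P by (auto simp: AP)
    then show "col (P * P) j = col P j"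
      using col_mult2[OF P P j] fixed[of "col P j"] P by auto
  qed (use P in auto)
  moreover have "{P *\<^sub>v v | v. v \<in> carrier_vec n} = alg_eigenspace A \<nu>"
    unfolding space using P APv fixed by (auto, metis)
  moreover have "alg_eigenspace A \<mu> \<subseteq> mat_kernel P" if "\<mu> \<noteq> \<nu>" for \<mu>
  proof
    fix v assume "v \<in> alg_eigenspace A \<mu>"
    then obtain k where "v \<in> mat_kernel (char_matrix A \<mu> ^\<^sub>m k)" by (auto simp: alg_eigenspace_def)
    then have v: "v \<in> carrier_vec n" "(char_matrix A \<mu> ^\<^sub>m k) *\<^sub>v v = 0\<^sub>v n"
      using mat_kernel[OF Ck] by auto
    \<comment> \<open>From P (A - mu) = (nu - mu) P: a power of the nonzero number nu - mu, times P
      v, has to vanish.\<close>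
    have "P *\<^sub>v ((char_matrix A \<mu> ^\<^sub>m k) *\<^sub>v w) = (\<nu> - \<mu>) ^ k \<cdot>\<^sub>v (P *\<^sub>v w)" if "w \<in> carrier_vec n" for w
      using that
    proof (induction k arbitrary: w)
      case 0
      then show ?case using A by (simp add: char_matrix_def)
    next
      case (Suc k)
      have w: "char_matrix A \<mu> *\<^sub>v w \<in> carrier_vec n" using C[of \<mu>] Suc.prems by auto
      have "(char_matrix A \<mu> ^\<^sub>m Suc k) *\<^sub>v w = (char_matrix A \<mu> ^\<^sub>m k) *\<^sub>v (char_matrix A \<mu> *\<^sub>v w)"
        using assoc_mult_mat_vec[OF Ck C Suc.prems] by simp
      then show ?case using Suc.IH[OF w] PCv[OF Suc.prems] by (simp add: smult_smult_assoc mult.commute)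
    qed
    from this[OF v(1)] have "(\<nu> - \<mu>) ^ k \<cdot>\<^sub>v (P *\<^sub>v v) = P *\<^sub>v 0\<^sub>v n"
      unfolding v(2) by simp
    also have "\<dots> = 0\<^sub>v n" using P by auto
    finally have "(\<nu> - \<mu>) ^ k \<cdot>\<^sub>v (P *\<^sub>v v) = 0\<^sub>v n" .
    then have "P *\<^sub>v v = 0\<^sub>v n"
      using that P by (auto simp: vec_eq_iff)
    then show "v \<in> mat_kernel P" using mat_kernel[OF P] v by auto
  qed
  ultimately show ?thesis using A P by (auto simp: is_eigenprojection_def)
qed

text \<open>Kernel vectors of \<open>C\<close> are determined by coordinate k, so every column of
  \<open>P\<close> is a multiple of one nonzero column x, and \<open>P\<close> is an outer product.
  Independence of \<open>{x}\<close> gives the lower bound.\<close>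

lemma rank_eq_1:
  fixes P :: "complex mat"
  assumes P: "P \<in> carrier_mat n n" "P \<noteq> 0\<^sub>m n n" and k: "k < n"
    and cols: "\<And>x. x \<in> carrier_vec n \<Longrightarrow> C *\<^sub>v x = 0\<^sub>v n \<Longrightarrow> x $ k = 0 \<Longrightarrow> x = 0\<^sub>v n"
    and C: "C \<in> carrier_mat n n" "C * P = 0\<^sub>m n n"
  shows "vec_space.rank n P = 1"
proof -
  interpret vec_space "TYPE(complex)" n .
  have Ccol: "C *\<^sub>v col P c = 0\<^sub>v n" if "c < n" for c
    using col_mult2[OF C(1) P(1) that] that by (simp add: C(2))
  obtain r0 c0 where rc: "r0 < n" "c0 < n" "P $$ (r0, c0) \<noteq> 0"
    using P by (metis carrier_matD eq_matI index_zero_mat)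
  define x where "x = col P c0"
  have x: "x \<in> carrier_vec n" "C *\<^sub>v x = 0\<^sub>v n" "x \<noteq> 0\<^sub>v n"
    using rc P Ccol[OF rc(2)] unfolding x_def by (auto simp: vec_eq_iff[of "col P c0"])
  then have xk: "x $ k \<noteq> 0" using cols by blast
  have "P $$ (r, c) = x $ r * (P $$ (k, c) / x $ k)" if "r < n" "c < n" for r c
  proof -
    let ?s = "P $$ (k, c) / x $ k"
    let ?y = "col P c - ?s \<cdot>\<^sub>v x"
    have "C *\<^sub>v ?y = 0\<^sub>v n"
      using x C P Ccol[OF that(2)] that
      by (subst mult_minus_distrib_mat_vec[of _ n n]) (auto simp: mult_mat_vec)
    moreover have "?y $ k = 0" using xk x P that k by auto
    moreover have "?y \<in> carrier_vec n" using x P by auto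
    ultimately have "?y $ r = 0" using cols[of ?y] that by simp
    then show ?thesis using x P that by (auto simp: mult.commute)
  qed
  then have "rank P \<le> 1" using P by (intro rank_le_1_product_entries[where f = "\<lambda>r. x $ r" and g = "\<lambda>c. P $$ (k, c) / x $ k"]) auto
  moreover have "rank P \<ge> 1"
  proof -
    have "\<not> lin_dep {x}"
    proof
      assume "lin_dep {x}"
      from finite_lin_dep[OF _ this] x(1) obtain a where "a x \<noteq> 0" "lincomb a {x} = 0\<^sub>v n"
        by auto
      then have "a x \<cdot>\<^sub>v x = 0\<^sub>v n" using x by (simp add: lincomb_def)
      then show False using \<open>a x \<noteq> 0\<close> x(1,3) by (auto simp: vec_eq_iff)
    qed
    moreover have "x \<in> set (cols P)" using rc P by (auto simp: x_def cols_def)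
    ultimately show ?thesis using rank_ge_card_indpt[OF P(1), of "{x}"] by simp
  qed
  ultimately show ?thesis by simp
qed

text \<open>The residue at nu of the resolvent (y - A)^(-1) = adj(y - A) / chi(y) when nu is a
  simple root.\<close>

definition eigenproj :: "complex mat \<Rightarrow> complex \<Rightarrow> complex mat" where
  "eigenproj A \<nu> = inverse (poly (pderiv (char_poly A)) \<nu>) \<cdot>\<^sub>m adj_mat (- char_matrix A \<nu>)"

text \<open>With X = nu - A, the identities X adj(X) = adj(X) X = det(X) = 0 give A P = P A = nu P,
  and division by chi'(nu) normalizes P so that it fixes eigenvectors. An eigenvector exists, so
  adj(X) has a nonzero entry, whose row index serves as the distinguished coordinate for the
  rank.\<close>

lemma simple_root_eigenproj:
  fixes A :: "complex mat"
  assumes A: "A \<in> carrier_mat n n" and root: "poly (char_poly A) \<nu> = 0"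
    and simple: "poly (pderiv (char_poly A)) \<nu> \<noteq> 0"
  shows "eigenproj A \<nu> \<in> carrier_mat n n" "A * eigenproj A \<nu> = \<nu> \<cdot>\<^sub>m eigenproj A \<nu>"
    "eigenproj A \<nu> * A = \<nu> \<cdot>\<^sub>m eigenproj A \<nu>"
    "\<And>v. v \<in> carrier_vec n \<Longrightarrow> A *\<^sub>v v = \<nu> \<cdot>\<^sub>v v \<Longrightarrow> eigenproj A \<nu> *\<^sub>v v = v"
    "vec_space.rank n (eigenproj A \<nu>) = 1"
proof -
  let ?X = "- char_matrix A \<nu>" and ?c = "inverse (poly (pderiv (char_poly A)) \<nu>)"
  let ?P = "eigenproj A \<nu>"
  have X: "?X \<in> carrier_mat n n" using A by auto
  have aX: "adj_mat ?X \<in> carrier_mat n n" using adj_mat(1)[OF X] .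
  have det: "det ?X = 0" using root char_poly_matrix[OF A] by simp
  show P: "?P \<in> carrier_mat n n" using aX by (simp add: eigenproj_def)
  have XP: "?X * ?P = 0\<^sub>m n n" "?P * ?X = 0\<^sub>m n n"
    unfolding eigenproj_def using mult_smult_distrib[OF X aX, of ?c] mult_smult_assoc_mat[OF aX X, of ?c]
    by (auto simp only: adj_mat(2,3)[OF X] det) auto
  have AX: "A = \<nu> \<cdot>\<^sub>m 1\<^sub>m n + - ?X" using A by (intro eq_matI) (auto simp: char_matrix_def)
  have mX: "- ?X \<in> carrier_mat n n" using X by auto
  have "A * ?P = \<nu> \<cdot>\<^sub>m 1\<^sub>m n * ?P + - ?X * ?P"
    by (subst AX, subst add_mult_distrib_mat[of _ n n]) (use P mX in auto)
  also have "- ?X * ?P = 0\<^sub>m n n"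
    using XP(1) X P by (subst uminus_mult_left_mat) auto
  also have "\<nu> \<cdot>\<^sub>m 1\<^sub>m n * ?P = \<nu> \<cdot>\<^sub>m ?P"
    using P by (subst mult_smult_assoc_mat[of _ n n _ n]) auto
  finally show AP: "A * ?P = \<nu> \<cdot>\<^sub>m ?P" using P by simp
  have "?P * A = ?P * (\<nu> \<cdot>\<^sub>m 1\<^sub>m n) + ?P * - ?X"
    by (subst AX, subst mult_add_distrib_mat[of _ n n]) (use P mX in auto)
  also have "?P * - ?X = 0\<^sub>m n n"
    using XP(2) X P by (subst uminus_mult_right_mat) auto
  also have "?P * (\<nu> \<cdot>\<^sub>m 1\<^sub>m n) = \<nu> \<cdot>\<^sub>m ?P"
    using P by (subst mult_smult_distrib[of _ n n _ n]) auto
  finally show "?P * A = \<nu> \<cdot>\<^sub>m ?P" using P by simp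
  show fixed: "?P *\<^sub>v v = v" if "v \<in> carrier_vec n" "A *\<^sub>v v = \<nu> \<cdot>\<^sub>v v" for v
  proof -
    have "?P *\<^sub>v v = ?c \<cdot>\<^sub>v (adj_mat ?X *\<^sub>v v)"
      unfolding eigenproj_def using aX that by (intro eq_vecI) (auto simp: scalar_prod_smult_left)
    then show ?thesis
      using simple by (simp add: adj_mat_mult_eigenvector[OF A that] smult_smult_assoc)
  qed
  obtain v where v: "v \<in> carrier_vec n" "v \<noteq> 0\<^sub>v n" "A *\<^sub>v v = \<nu> \<cdot>\<^sub>v v"
    using root A by (auto simp: eigenvalue_root_char_poly[OF A, symmetric] eigenvalue_def eigenvector_def)
  have P0: "?P \<noteq> 0\<^sub>m n n"
  proof
    assume "?P = 0\<^sub>m n n"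
    then have "v = 0\<^sub>m n n *\<^sub>v v" using fixed[OF v(1,3)] by simp
    also have "\<dots> = 0\<^sub>v n" using v(1) by (intro eq_vecI) auto
    finally show False using v(2) by simp
  qed
  have "adj_mat ?X \<noteq> 0\<^sub>m n n"
  proof
    assume "adj_mat ?X = 0\<^sub>m n n"
    then have "?P = 0\<^sub>m n n" by (simp add: eigenproj_def)
    then show False using P0 by simp
  qed
  then obtain k l where kl: "k < n" "l < n" "adj_mat ?X $$ (k, l) \<noteq> 0"
    using aX by (metis carrier_matD eq_matI index_zero_mat)
  show "vec_space.rank n ?P = 1"
    using rank_eq_1[OF P P0 kl(1) _ X XP(1)] adj_mat_kernel_unique[OF X kl] by blast
qed

section \<open>Hermitian matrices\<close>

definition ctrans :: "complex mat \<Rightarrow> complex mat" where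
  "ctrans A = mat (dim_col A) (dim_row A) (\<lambda>(i, j). cnj (A $$ (j, i)))"

lemma ctrans_carrier [simp]: "ctrans A \<in> carrier_mat n m \<longleftrightarrow> A \<in> carrier_mat m n"
  unfolding ctrans_def carrier_mat_def by auto

lemma ctrans_dim [simp]: "dim_row (ctrans A) = dim_col A" "dim_col (ctrans A) = dim_row A"
  by (auto simp: ctrans_def)

lemma ctrans_index [simp]:
  "i < dim_col A \<Longrightarrow> j < dim_row A \<Longrightarrow> ctrans A $$ (i, j) = cnj (A $$ (j, i))"
  by (simp add: ctrans_def)

lemma ctrans_ctrans [simp]: "ctrans (ctrans A) = A"
  by (rule eq_matI) auto

lemma ctrans_mult:
  assumes "A \<in> carrier_mat nr n" "B \<in> carrier_mat n nc"
  shows "ctrans (A * B) = ctrans B * ctrans A"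
  using assms by (intro eq_matI) (auto simp: scalar_prod_def mult.commute)

lemma cscalar_prod_mult_mat_vec:
  assumes "A \<in> carrier_mat n m" "v \<in> carrier_vec m" "w \<in> carrier_vec n"
  shows "(A *\<^sub>v v) \<bullet>c w = v \<bullet>c (ctrans A *\<^sub>v w)"
proof -
  have "(A *\<^sub>v v) \<bullet>c w = (\<Sum>i<n. \<Sum>j<m. A $$ (i, j) * v $ j * cnj (w $ i))"
    using assms by (auto simp: scalar_prod_def sum_distrib_right atLeast0LessThan intro!: sum.cong)
  also have "\<dots> = (\<Sum>j<m. \<Sum>i<n. A $$ (i, j) * v $ j * cnj (w $ i))"
    by (rule sum.swap)
  also have "\<dots> = v \<bullet>c (ctrans A *\<^sub>v w)"
    using assms
    by (auto simp: scalar_prod_def sum_distrib_left atLeast0LessThan mult_ac intro!: sum.cong)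
  finally show ?thesis .
qed

definition hermitian_mat :: "nat \<Rightarrow> complex mat \<Rightarrow> bool" where
  "hermitian_mat n A \<longleftrightarrow> A \<in> carrier_mat n n \<and> ctrans A = A"

definition unitary_mat :: "nat \<Rightarrow> complex mat \<Rightarrow> bool" where
  "unitary_mat n U \<longleftrightarrow> U \<in> carrier_mat n n \<and> ctrans U * U = 1\<^sub>m n"

definition diag_of :: "nat \<Rightarrow> (nat \<Rightarrow> complex) \<Rightarrow> complex mat" where
  "diag_of n e = mat n n (\<lambda>(i, j). if i = j then e i else 0)"

lemma diag_of_carrier [simp]: "diag_of n e \<in> carrier_mat n n"
  by (simp add: diag_of_def)

lemma unitary_mat_right_inverse:
  assumes "unitary_mat n U" shows "U * ctrans U = 1\<^sub>m n"
  using assms mat_mult_left_right_inverse[of "ctrans U" n U] by (auto simp: unitary_mat_def)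

text \<open>Basis completion and Gram-Schmidt keep v as the first vector; the final normalization
  rescales it, whence the factor c.\<close>

lemma unitary_mat_with_first_column:
  fixes v :: "complex vec"
  assumes v: "v \<in> carrier_vec n" "v \<noteq> 0\<^sub>v n" and n: "n > 0"
  obtains U c where "unitary_mat n U" "col U 0 = c \<cdot>\<^sub>v v" "c \<noteq> 0"
proof -
  interpret cof_vec_space n "TYPE(complex)" .
  define b where "b = basis_completion v"
  define ws where "ws = gram_schmidt n b"
  note bc = basis_completion[OF v, folded b_def]
  obtain vs where bv: "b = v # vs" using bc(6,7) n by (cases b) auto
  have ws: "set ws \<subseteq> carrier_vec n" "corthogonal ws" "length ws = n"
    using gram_schmidt_result[OF bc(2,4,5) refl, folded ws_def] bc(6) by auto
  have hdws: "hd ws = v" using gram_schmidt_hd[OF v(1), of vs, folded bv] by (simp add: ws_def)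
  then have ws0: "ws ! 0 = v" using ws(3) n by (metis hd_conv_nth length_0_conv less_irrefl)
  define c :: "nat \<Rightarrow> complex" where "c i = 1 / sqrt (cmod (ws ! i \<bullet>c ws ! i))" for i
  define U where "U = mat n n (\<lambda>(k, i). c i * ws ! i $ k)"
  have wsc: "ws ! i \<in> carrier_vec n" if "i < n" for i using ws that by (metis nth_mem subsetD)
  have nz: "ws ! i \<bullet>c ws ! i \<noteq> 0" if "i < n" for i
    using corthogonalD[OF ws(2), of i i] that ws(3) by auto
  have pos: "ws ! i \<bullet>c ws ! i = of_real (cmod (ws ! i \<bullet>c ws ! i))" if "i < n" for i
    using conjugate_square_ge_0_vec[of "ws ! i"]
    by (simp add: less_eq_complex_def complex_eq_iff cmod_eq_Re)
  have cc: "cnj (c i) = c i" for i by (simp add: c_def)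
  have "ctrans U * U = 1\<^sub>m n"
  proof (rule eq_matI)
    fix i j assume ij: "i < dim_row (1\<^sub>m n)" "j < dim_col (1\<^sub>m n)"
    then have ij': "i < n" "j < n" by auto
    have "(ctrans U * U) $$ (i, j) = c i * c j * (ws ! j \<bullet>c ws ! i)"
      using ij' wsc[OF ij'(1)] wsc[OF ij'(2)]
      by (auto simp: U_def scalar_prod_def cc sum_distrib_left mult_ac intro!: sum.cong)
    also have "\<dots> = 1\<^sub>m n $$ (i, j)"
    proof (cases "i = j")
      case True
      define r where "r = cmod (ws ! i \<bullet>c ws ! i)"
      have "r > 0" "ws ! i \<bullet>c ws ! i = of_real r" "c i = of_real (1 / sqrt r)"
        using nz[OF ij'(1)] pos[OF ij'(1)] by (auto simp: r_def c_def)
      then have "c i * c i * (ws ! i \<bullet>c ws ! i) = of_real (1 / sqrt r * (1 / sqrt r) * r)"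
        by (simp only: of_real_mult)
      also have "1 / sqrt r * (1 / sqrt r) * r = 1" using \<open>r > 0\<close> by (simp add: field_simps)
      finally have "c i * c i * (ws ! i \<bullet>c ws ! i) = 1" by simp
      then show ?thesis using True ij' by simp
    next
      case False
      then show ?thesis using corthogonalD[OF ws(2), of j i] ij' ws(3) by auto
    qed
    finally show "(ctrans U * U) $$ (i, j) = 1\<^sub>m n $$ (i, j)" .
  qed (auto simp: U_def)
  then have "unitary_mat n U" by (auto simp: unitary_mat_def U_def)
  moreover have "col U 0 = c 0 \<cdot>\<^sub>v v"
    using n v(1) by (intro eq_vecI) (auto simp: U_def ws0)
  moreover have "c 0 \<noteq> 0" using nz[OF n] by (simp add: c_def)
  ultimately show thesis using that by blast
qed

lemma complex_eigenvector_exists: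
  fixes A :: "complex mat"
  assumes A: "A \<in> carrier_mat n n" and n: "n > 0"
  obtains v k where "v \<in> carrier_vec n" "v \<noteq> 0\<^sub>v n" "A *\<^sub>v v = k \<cdot>\<^sub>v v"
proof -
  have "degree (char_poly A) = n" using degree_monic_char_poly[OF A] by simp
  then obtain k where "poly (char_poly A) k = 0"
    using fundamental_theorem_of_algebra[of "char_poly A"] n
    by (auto simp: constant_degree)
  then have "eigenvalue A k" by (simp add: eigenvalue_root_char_poly[OF A])
  then show thesis using that A by (auto simp: eigenvalue_def eigenvector_def)
qed

lemma hermitian_mat_congruence:
  assumes "hermitian_mat n A" "U \<in> carrier_mat n m"
  shows "hermitian_mat m (ctrans U * A * U)"
proof -
  have A: "A \<in> carrier_mat n n" "ctrans A = A" using assms by (auto simp: hermitian_mat_def)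
  have "ctrans (ctrans U * A * U) = ctrans U * ctrans (ctrans U * A)"
    using A assms by (subst ctrans_mult[of _ m n _ m]) auto
  also have "ctrans (ctrans U * A) = A * U"
    using A assms by (subst ctrans_mult[of _ m n _ n]) auto
  also have "ctrans U * (A * U) = ctrans U * A * U"
    using A assms by (subst assoc_mult_mat[of _ m n _ n _ m]) auto
  finally show ?thesis using A assms by (auto simp: hermitian_mat_def)
qed

lemma hermitian_mat_index:
  "hermitian_mat n A \<Longrightarrow> i < n \<Longrightarrow> j < n \<Longrightarrow> cnj (A $$ (j, i)) = A $$ (i, j)"
  unfolding hermitian_mat_def by (metis carrier_matD ctrans_index)

text \<open>Deflation: an eigenvector as first column of a unitary \<open>U\<close> turns the first
  column of \<open>ctrans U * A * U\<close> into k e_1. Hermiticity clears the first row as well and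
  makes k real, and the induction hypothesis handles the remaining block.\<close>

theorem hermitian_mat_diagonalization:
  assumes "hermitian_mat n A"
  shows "\<exists>U e. unitary_mat n U \<and> A = U * diag_of n (\<lambda>i. complex_of_real (e i)) * ctrans U"
  using assms
proof (induction n arbitrary: A)
  case 0
  then show ?case
    by (intro exI[of _ "1\<^sub>m 0"] exI) (auto simp: unitary_mat_def hermitian_mat_def intro!: eq_matI)
next
  case (Suc m)
  let ?n = "Suc m"
  have A: "A \<in> carrier_mat ?n ?n" "ctrans A = A" using Suc.prems by (auto simp: hermitian_mat_def)
  obtain v k where v: "v \<in> carrier_vec ?n" "v \<noteq> 0\<^sub>v ?n" and eig: "A *\<^sub>v v = k \<cdot>\<^sub>v v"
    using complex_eigenvector_exists[OF A(1)] by blast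
  obtain U c where U: "unitary_mat ?n U" and col0: "col U 0 = c \<cdot>\<^sub>v v" and c: "c \<noteq> 0"
    using unitary_mat_with_first_column[OF v] by auto
  have Uc: "U \<in> carrier_mat ?n ?n" and UU: "ctrans U * U = 1\<^sub>m ?n" and UU': "U * ctrans U = 1\<^sub>m ?n"
    using U unitary_mat_right_inverse by (auto simp: unitary_mat_def)
  define A1 where "A1 = ctrans U * A * U"
  have A1h: "hermitian_mat ?n A1"
    unfolding A1_def by (rule hermitian_mat_congruence[OF Suc.prems Uc])
  then have A1c: "A1 \<in> carrier_mat ?n ?n" by (simp add: hermitian_mat_def)
  have eig0: "A *\<^sub>v col U 0 = k \<cdot>\<^sub>v col U 0"
    unfolding col0 using A v eig by (auto simp: mult_mat_vec smult_smult_assoc mult.commute)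
  have A10: "A1 $$ (i, 0) = (if i = 0 then k else 0)" if i: "i < ?n" for i
  proof -
    have "A1 = ctrans U * (A * U)"
      unfolding A1_def using A Uc by (subst assoc_mult_mat[of _ ?n ?n _ ?n _ ?n]) auto
    then have "A1 $$ (i, 0) = row (ctrans U) i \<bullet> col (A * U) 0"
      using i Uc A by auto
    also have "col (A * U) 0 = A *\<^sub>v col U 0" using A Uc by (subst col_mult2[of _ ?n ?n _ ?n]) auto
    also have "\<dots> = k \<cdot>\<^sub>v col U 0" by (rule eig0)
    also have "row (ctrans U) i \<bullet> (k \<cdot>\<^sub>v col U 0) = k * (ctrans U * U) $$ (i, 0)"
      using i Uc by (auto simp: scalar_prod_smult_right)
    finally show ?thesis using i by (simp add: UU)
  qed
  have A1_0: "A1 $$ (0, j) = (if j = 0 then k else 0)" if j: "j < ?n" for j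
  proof (cases "j = 0")
    case True then show ?thesis using A10[of 0] by simp
  next
    case False
    then show ?thesis using hermitian_mat_index[OF A1h, of 0 j] A10[OF j] j by auto
  qed
  have kreal: "k = of_real (Re k)"
    using hermitian_mat_index[OF A1h, of 0 0] A10[of 0] by (simp add: complex_eq_iff)
  define A2 where "A2 = mat m m (\<lambda>(i, j). A1 $$ (Suc i, Suc j))"
  have "hermitian_mat m A2"
    using hermitian_mat_index[OF A1h] by (auto simp: hermitian_mat_def A2_def intro!: eq_matI)
  from Suc.IH[OF this] obtain U2 e2 where U2: "unitary_mat m U2"
    and A2: "A2 = U2 * diag_of m (\<lambda>i. complex_of_real (e2 i)) * ctrans U2" by blast
  have U2c: "U2 \<in> carrier_mat m m" and UU2: "ctrans U2 * U2 = 1\<^sub>m m" using U2 by (auto simp: unitary_mat_def)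
  let ?o = "1\<^sub>m 1 :: complex mat" and ?r = "0\<^sub>m 1 m :: complex mat" and ?z = "0\<^sub>m m 1 :: complex mat"
  define V where "V = four_block_mat ?o ?r ?z U2"
  define e where "e i = (if i = 0 then Re k else e2 (i - 1))" for i
  define D where "D = diag_of ?n (\<lambda>i. complex_of_real (e i))"
  let ?K = "mat 1 1 (\<lambda>_. k)"
  let ?D2 = "diag_of m (\<lambda>i. complex_of_real (e2 i))"
  have Vc: "V \<in> carrier_mat ?n ?n" using U2c by (auto simp: V_def)
  have ctV: "ctrans V = four_block_mat ?o ?r ?z (ctrans U2)"
    using U2c by (intro eq_matI) (auto simp: V_def less_Suc_eq)
  have Deq: "D = four_block_mat ?K ?r ?z ?D2"
    by (intro eq_matI) (auto simp: D_def diag_of_def e_def kreal[symmetric])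
  have z: "0\<^sub>m (Suc 0) m * X = 0\<^sub>m (Suc 0) m" "X * 0\<^sub>m m (Suc 0) = 0\<^sub>m m (Suc 0)"
    if "X \<in> carrier_mat m m" for X :: "complex mat"
    using that by auto
  have VV: "ctrans V * V = 1\<^sub>m ?n"
  proof -
    have "ctrans V * V = four_block_mat ?o ?r ?z (ctrans U2 * U2)"
      unfolding ctV unfolding V_def using U2c
      by (subst mult_four_block_mat[of _ 1 1 _ m _ m _ _ 1 _ m]) (auto simp: z)
    then show ?thesis using UU2 four_block_one_mat[of 1 m] by simp
  qed
  have A1eq: "A1 = V * D * ctrans V"
  proof -
    have "V * D = four_block_mat ?K ?r ?z (U2 * ?D2)"
      unfolding Deq V_def using U2c
      by (subst mult_four_block_mat[of _ 1 1 _ m _ m _ _ 1 _ m]) (auto simp: z)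
    then have "V * D * ctrans V = four_block_mat ?K ?r ?z (U2 * ?D2) * four_block_mat ?o ?r ?z (ctrans U2)"
      by (simp add: ctV)
    also have "\<dots> = four_block_mat ?K ?r ?z A2"
      unfolding A2 using U2c
      by (subst mult_four_block_mat[of _ 1 1 _ m _ m _ _ 1 _ m]) (auto simp: z)
    also have "\<dots> = A1"
      using A1c A10 A1_0 by (intro eq_matI) (auto simp: A2_def)
    finally show ?thesis ..
  qed
  have Dc: "D \<in> carrier_mat ?n ?n" by (simp add: D_def)
  have "A = U * A1 * ctrans U"
  proof -
    have "U * A1 * ctrans U = (U * ctrans U) * A * (U * ctrans U)"
      unfolding A1_def using A Uc by (simp add: assoc_mult_mat[of _ ?n ?n _ ?n _ ?n])
    then show ?thesis using A UU' by simp
  qed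
  also have "\<dots> = (U * V) * D * ctrans (U * V)"
    unfolding A1eq using Uc Vc Dc
    by (subst ctrans_mult[of U ?n ?n V ?n]) (auto simp: assoc_mult_mat[of _ ?n ?n _ ?n _ ?n])
  finally have 1: "A = (U * V) * D * ctrans (U * V)" .
  have "ctrans (U * V) * (U * V) = ctrans V * (ctrans U * U) * V"
    using Uc Vc by (subst ctrans_mult[of U ?n ?n V ?n]) (auto simp: assoc_mult_mat[of _ ?n ?n _ ?n _ ?n])
  also have "\<dots> = 1\<^sub>m ?n" using UU VV Vc by simp
  finally have "unitary_mat ?n (U * V)" using Uc Vc by (simp add: unitary_mat_def)
  then show ?case using 1 unfolding D_def by blast
qed

section \<open>Perturbation of Hermitian spectra and square roots\<close>

text \<open>Transports matrix products and eigenvalues along entrywise conjugation, for the realness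
  of square roots and the reflection of spectra.\<close>

interpretation cnj_hom: inj_comm_ring_hom cnj
  by unfold_locales auto

definition sq_norm :: "complex vec \<Rightarrow> real" where
  "sq_norm v = (\<Sum>i<dim_vec v. (cmod (v $ i))\<^sup>2)"

lemma cscalar_self: "v \<bullet>c v = of_real (sq_norm v)"
  by (simp add: scalar_prod_def sq_norm_def atLeast0LessThan complex_norm_square[symmetric])

lemma diag_of_mult_vec:
  "c \<in> carrier_vec n \<Longrightarrow> diag_of n f *\<^sub>v c = vec n (\<lambda>i. f i * c $ i)"
  by (intro eq_vecI) (auto simp: diag_of_def scalar_prod_def if_distrib[of "\<lambda>a. a * _"] cong: if_cong)

lemma diag_of_mult: "diag_of n f * diag_of n g = diag_of n (\<lambda>i. f i * g i)"
proof (rule eq_matI)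
  fix i j assume "i < dim_row (diag_of n (\<lambda>i. f i * g i))" "j < dim_col (diag_of n (\<lambda>i. f i * g i))"
  then have ij: "i < n" "j < n" by (auto simp: diag_of_def)
  have "(diag_of n f * diag_of n g) $$ (i, j) =
      (\<Sum>k = 0..<n. (if i = k then f i else 0) * (if k = j then g k else 0))"
    using ij by (auto simp: diag_of_def scalar_prod_def)
  also have "\<dots> = (\<Sum>k = 0..<n. if k = i then (if i = j then f i * g i else 0) else 0)"
    by (intro sum.cong) auto
  finally have "(diag_of n f * diag_of n g) $$ (i, j) =
      (\<Sum>k = 0..<n. if k = i then (if i = j then f i * g i else 0) else 0)" .
  then show "(diag_of n f * diag_of n g) $$ (i, j) = diag_of n (\<lambda>i. f i * g i) $$ (i, j)"
    using ij by (simp add: diag_of_def)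
qed (auto simp: diag_of_def)

lemma sq_norm_pos: "v \<in> carrier_vec n \<Longrightarrow> v \<noteq> 0\<^sub>v n \<Longrightarrow> sq_norm v > 0"
proof -
  assume v: "v \<in> carrier_vec n" "v \<noteq> 0\<^sub>v n"
  then obtain i where "i < n" "v $ i \<noteq> 0" by (auto simp: vec_eq_iff)
  then show ?thesis unfolding sq_norm_def using v by (intro sum_pos2[of _ i]) auto
qed

lemma sq_norm_unitary:
  assumes "unitary_mat n U" "v \<in> carrier_vec n"
  shows "sq_norm (U *\<^sub>v v) = sq_norm v"
proof -
  have U: "U \<in> carrier_mat n n" "ctrans U * U = 1\<^sub>m n" using assms by (auto simp: unitary_mat_def)
  have "(U *\<^sub>v v) \<bullet>c (U *\<^sub>v v) = v \<bullet>c (ctrans U *\<^sub>v (U *\<^sub>v v))"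
    using U assms(2) by (intro cscalar_prod_mult_mat_vec) auto
  also have "ctrans U *\<^sub>v (U *\<^sub>v v) = v"
    using assoc_mult_mat_vec[of "ctrans U" n n U n v] U assms(2) by simp
  finally show ?thesis unfolding cscalar_self of_real_eq_iff .
qed

lemma hermitian_mat_eigen_expansion:
  assumes A: "hermitian_mat n A"
  obtains U e where "unitary_mat n U" "A = U * diag_of n (\<lambda>i. complex_of_real (e i)) * ctrans U"
    "\<And>i. i < n \<Longrightarrow> A *\<^sub>v col U i = complex_of_real (e i) \<cdot>\<^sub>v col U i"
    "\<And>i. i < n \<Longrightarrow> sq_norm (col U i) = 1"
proof -
  obtain U e where U: "unitary_mat n U"
    and A': "A = U * diag_of n (\<lambda>i. complex_of_real (e i)) * ctrans U"
    using hermitian_mat_diagonalization[OF A] by blast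
  let ?D = "diag_of n (\<lambda>i. complex_of_real (e i))"
  have Uc: "U \<in> carrier_mat n n" and UU: "ctrans U * U = 1\<^sub>m n" using U by (auto simp: unitary_mat_def)
  have "A *\<^sub>v col U i = complex_of_real (e i) \<cdot>\<^sub>v col U i" if i: "i < n" for i
  proof -
    have col: "col U i = U *\<^sub>v unit_vec n i" using Uc i by (intro eq_vecI) auto
    have "A * U = U * ?D * (ctrans U * U)"
      unfolding A' using Uc by (intro assoc_mult_mat[of _ n n _ n _ n]) auto
    then have AU: "A * U = U * ?D" using Uc by (simp add: UU right_mult_one_mat[of _ n n])
    have "A *\<^sub>v col U i = col (A * U) i"
      using A Uc i by (subst col_mult2[of _ n n _ n]) (auto simp: hermitian_mat_def)
    also have "\<dots> = U *\<^sub>v col ?D i" unfolding AU using Uc i by (subst col_mult2[of _ n n _ n]) auto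
    also have "col ?D i = complex_of_real (e i) \<cdot>\<^sub>v unit_vec n i"
      using i by (intro eq_vecI) (auto simp: diag_of_def)
    also have "U *\<^sub>v (complex_of_real (e i) \<cdot>\<^sub>v unit_vec n i) = complex_of_real (e i) \<cdot>\<^sub>v col U i"
      unfolding col using Uc by (subst mult_mat_vec[of _ n n]) auto
    finally show ?thesis .
  qed
  moreover have "sq_norm (col U i) = 1" if i: "i < n" for i
  proof -
    have col: "col U i = U *\<^sub>v unit_vec n i" using Uc i by (intro eq_vecI) auto
    have "sq_norm (unit_vec n i) = (\<Sum>j<n. if j = i then 1 else 0)"
      unfolding sq_norm_def by (intro sum.cong) (auto simp: unit_vec_def)
    then show ?thesis using i sq_norm_unitary[OF U, of "unit_vec n i"] by (simp add: col)
  qed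
  ultimately show thesis using U A' that by blast
qed

text \<open>Parseval in an eigenbasis for x + y A with complex x and y; \<open>c v i\<close> is the
  i-th coordinate of v. This covers both z \<Omega> and x + i B, which are normal though not
  Hermitian in general.\<close>

lemma hermitian_mat_sq_norm_expansion:
  assumes A: "hermitian_mat n A"
  obtains e c where "\<And>i. i < n \<Longrightarrow> eigenvalue A (complex_of_real (e i))"
    "\<And>v x y. v \<in> carrier_vec n \<Longrightarrow>
       sq_norm (x \<cdot>\<^sub>v v + y \<cdot>\<^sub>v (A *\<^sub>v v)) = (\<Sum>i<n. (cmod (x + y * e i))\<^sup>2 * (cmod (c v i))\<^sup>2)"
proof -
  obtain U e where U: "unitary_mat n U" and A': "A = U * diag_of n (\<lambda>i. complex_of_real (e i)) * ctrans U"
    and ev: "\<And>i. i < n \<Longrightarrow> A *\<^sub>v col U i = complex_of_real (e i) \<cdot>\<^sub>v col U i"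
    and nrm: "\<And>i. i < n \<Longrightarrow> sq_norm (col U i) = 1"
    using hermitian_mat_eigen_expansion[OF A] by metis
  let ?D = "diag_of n (\<lambda>i. complex_of_real (e i))"
  have Ac: "A \<in> carrier_mat n n" using A by (simp add: hermitian_mat_def)
  have Uc: "U \<in> carrier_mat n n" using U by (auto simp: unitary_mat_def)
  have UU': "U * ctrans U = 1\<^sub>m n" by (rule unitary_mat_right_inverse[OF U])
  show thesis
  proof (rule that[of e "\<lambda>v i. (ctrans U *\<^sub>v v) $ i"])
    fix i assume i: "i < n"
    have "col U i \<noteq> 0\<^sub>v n"
    proof
      assume "col U i = 0\<^sub>v n"
      then have "sq_norm (col U i) = 0" by (simp add: sq_norm_def)
      then show False using nrm[OF i] by simp
    qed
    then show "eigenvalue A (complex_of_real (e i))"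
      unfolding eigenvalue_def eigenvector_def using ev[OF i] Uc Ac
      by (intro exI[of _ "col U i"]) auto
  next
    fix v :: "complex vec" and x y assume v: "v \<in> carrier_vec n"
    define c where "c = ctrans U *\<^sub>v v"
    have c: "c \<in> carrier_vec n" using Uc v by (auto simp: c_def)
    have Uc': "U *\<^sub>v c = v" unfolding c_def
      using assoc_mult_mat_vec[of U n n "ctrans U" n v] Uc v by (simp add: UU')
    have Dc: "?D *\<^sub>v c \<in> carrier_vec n" using c by (simp add: diag_of_mult_vec)
    have "A *\<^sub>v v = (U * ?D) *\<^sub>v c"
      unfolding A' c_def using Uc v by (intro assoc_mult_mat_vec[of _ n n _ n]) auto
    also have "\<dots> = U *\<^sub>v (?D *\<^sub>v c)"
      using Uc c by (intro assoc_mult_mat_vec[of _ n n _ n]) auto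
    finally have "x \<cdot>\<^sub>v v + y \<cdot>\<^sub>v (A *\<^sub>v v) = x \<cdot>\<^sub>v (U *\<^sub>v c) + y \<cdot>\<^sub>v (U *\<^sub>v (?D *\<^sub>v c))"
      by (simp add: Uc')
    also have "\<dots> = U *\<^sub>v (x \<cdot>\<^sub>v c + y \<cdot>\<^sub>v (?D *\<^sub>v c))"
      using c Dc mult_mat_vec[OF Uc c] mult_mat_vec[OF Uc Dc]
      by (subst mult_add_distrib_mat_vec[OF Uc]) auto
    finally have "sq_norm (x \<cdot>\<^sub>v v + y \<cdot>\<^sub>v (A *\<^sub>v v)) = sq_norm (x \<cdot>\<^sub>v c + y \<cdot>\<^sub>v (?D *\<^sub>v c))"
      using sq_norm_unitary[OF U, of "x \<cdot>\<^sub>v c + y \<cdot>\<^sub>v (?D *\<^sub>v c)"] c Dc by simp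
    also have "\<dots> = (\<Sum>i<n. (cmod (x + y * e i))\<^sup>2 * (cmod (c $ i))\<^sup>2)"
    proof -
      have "x \<cdot>\<^sub>v c + y \<cdot>\<^sub>v (?D *\<^sub>v c) = vec n (\<lambda>i. (x + y * e i) * c $ i)"
        using c by (intro eq_vecI) (auto simp: diag_of_mult_vec algebra_simps)
      then show ?thesis by (simp add: sq_norm_def norm_mult power_mult_distrib)
    qed
    finally show "sq_norm (x \<cdot>\<^sub>v v + y \<cdot>\<^sub>v (A *\<^sub>v v)) =
      (\<Sum>i<n. (cmod (x + y * e i))\<^sup>2 * (cmod ((ctrans U *\<^sub>v v) $ i))\<^sup>2)" by (simp add: c_def)
  qed
qed

text \<open>An eigenvector v satisfies z \<Omega> v = (x + i B) v. The left side has norm at most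
  |z| \<omega> |v|; if x were farther than |z| \<omega> from -i t for every eigenvalue t of
  \<open>B\<close>, the right side would be strictly longer.\<close>

lemma eigenvalue_perturbation:
  assumes B: "hermitian_mat n B" and \<Omega>: "hermitian_mat n \<Omega>"
    and bound: "\<And>t. eigenvalue \<Omega> (complex_of_real t) \<Longrightarrow> \<bar>t\<bar> \<le> \<omega>"
    and ev: "eigenvalue (z \<cdot>\<^sub>m \<Omega> - \<i> \<cdot>\<^sub>m B) x"
  obtains t where "eigenvalue B (complex_of_real t)" "cmod (x + \<i> * t) \<le> cmod z * \<omega>"
proof (rule ccontr)
  assume "\<not> thesis"
  with that have far: "cmod z * \<omega> < cmod (x + \<i> * t)" if "eigenvalue B (complex_of_real t)" for t
    using that by force
  have Bc: "B \<in> carrier_mat n n" and Oc: "\<Omega> \<in> carrier_mat n n" using B \<Omega> by (auto simp: hermitian_mat_def)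
  obtain v where v: "v \<in> carrier_vec n" "v \<noteq> 0\<^sub>v n" and eq: "(z \<cdot>\<^sub>m \<Omega> - \<i> \<cdot>\<^sub>m B) *\<^sub>v v = x \<cdot>\<^sub>v v"
    using ev Bc Oc by (auto simp: eigenvalue_def eigenvector_def)
  \<comment> \<open>The coefficient 0 puts both sides into the shape required by the norm
    expansion.\<close>
  have zv: "0 \<cdot>\<^sub>v v + z \<cdot>\<^sub>v (\<Omega> *\<^sub>v v) = x \<cdot>\<^sub>v v + \<i> \<cdot>\<^sub>v (B *\<^sub>v v)"
  proof (rule eq_vecI)
    fix i assume "i < dim_vec (x \<cdot>\<^sub>v v + \<i> \<cdot>\<^sub>v (B *\<^sub>v v))"
    then have i: "i < n" using Bc by simp
    have "((z \<cdot>\<^sub>m \<Omega> - \<i> \<cdot>\<^sub>m B) *\<^sub>v v) $ i = (z \<cdot>\<^sub>v (\<Omega> *\<^sub>v v)) $ i - (\<i> \<cdot>\<^sub>v (B *\<^sub>v v)) $ i"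
      using i Bc Oc v
      by (simp add: scalar_prod_def sum_subtractf sum_distrib_left algebra_simps)
    then show "(0 \<cdot>\<^sub>v v + z \<cdot>\<^sub>v (\<Omega> *\<^sub>v v)) $ i = (x \<cdot>\<^sub>v v + \<i> \<cdot>\<^sub>v (B *\<^sub>v v)) $ i"
      using i Bc Oc v by (simp add: eq)
  qed (use Bc Oc v in auto)
  obtain e c where e: "\<And>i. i < n \<Longrightarrow> eigenvalue B (complex_of_real (e i))"
    and ec: "\<And>v x y. v \<in> carrier_vec n \<Longrightarrow>
       sq_norm (x \<cdot>\<^sub>v v + y \<cdot>\<^sub>v (B *\<^sub>v v)) = (\<Sum>i<n. (cmod (x + y * complex_of_real (e i)))\<^sup>2 * (cmod (c v i))\<^sup>2)"
    using hermitian_mat_sq_norm_expansion[OF B] by blast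
  obtain f d where f: "\<And>i. i < n \<Longrightarrow> eigenvalue \<Omega> (complex_of_real (f i))"
    and fd: "\<And>v x y. v \<in> carrier_vec n \<Longrightarrow>
       sq_norm (x \<cdot>\<^sub>v v + y \<cdot>\<^sub>v (\<Omega> *\<^sub>v v)) = (\<Sum>i<n. (cmod (x + y * complex_of_real (f i)))\<^sup>2 * (cmod (d v i))\<^sup>2)"
    using hermitian_mat_sq_norm_expansion[OF \<Omega>] by blast
  have v1: "1 \<cdot>\<^sub>v v + 0 \<cdot>\<^sub>v (B *\<^sub>v v) = v" "1 \<cdot>\<^sub>v v + 0 \<cdot>\<^sub>v (\<Omega> *\<^sub>v v) = v" using v Bc Oc by auto
  have sc: "sq_norm v = (\<Sum>i<n. (cmod (c v i))\<^sup>2)" using ec[OF v(1), of 1 0, unfolded v1] by simp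
  have sd: "sq_norm v = (\<Sum>i<n. (cmod (d v i))\<^sup>2)" using fd[OF v(1), of 1 0, unfolded v1] by simp
  have "n > 0" using v by (cases n) auto
  then have \<omega>0: "0 \<le> \<omega>" using bound[OF f[of 0]] by linarith
  let ?K = "cmod z * \<omega>"
  have K0: "0 \<le> ?K" using \<omega>0 by simp
  have "(\<Sum>i<n. (cmod (0 + z * complex_of_real (f i)))\<^sup>2 * (cmod (d v i))\<^sup>2) \<le> (\<Sum>i<n. ?K\<^sup>2 * (cmod (d v i))\<^sup>2)"
  proof (intro sum_mono mult_right_mono power_mono)
    fix i assume "i \<in> {..<n}"
    then have "\<bar>f i\<bar> \<le> \<omega>" using bound f by auto
    then show "cmod (0 + z * complex_of_real (f i)) \<le> ?K" by (simp add: norm_mult mult_left_mono)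
  qed auto
  also have "\<dots> = ?K\<^sup>2 * sq_norm v" by (simp add: sd sum_distrib_left)
  also have "\<dots> = (\<Sum>i<n. ?K\<^sup>2 * (cmod (c v i))\<^sup>2)" by (simp add: sc sum_distrib_left)
  also have "\<dots> < (\<Sum>i<n. (cmod (x + \<i> * complex_of_real (e i)))\<^sup>2 * (cmod (c v i))\<^sup>2)"
  proof (rule sum_strict_mono_ex1)
    have lt: "?K\<^sup>2 < (cmod (x + \<i> * complex_of_real (e i)))\<^sup>2" if "i < n" for i
      using far[OF e[OF that]] K0 by (intro power_strict_mono) auto
    then show "\<forall>i\<in>{..<n}. ?K\<^sup>2 * (cmod (c v i))\<^sup>2 \<le> (cmod (x + \<i> * complex_of_real (e i)))\<^sup>2 * (cmod (c v i))\<^sup>2"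
      by (intro ballI mult_right_mono) (auto intro: less_imp_le)
    \<comment> \<open>Strictness needs one nonzero coordinate, which v \<noteq> 0 provides.\<close>
    obtain i where i: "i < n" "c v i \<noteq> 0"
    proof (rule ccontr)
      assume "\<not> thesis"
      with that have "c v i = 0" if "i < n" for i using \<open>i < n\<close> by blast
      then have "sq_norm v = 0" by (simp add: sc)
      then show False using sq_norm_pos[OF v] by simp
    qed
    then show "\<exists>i\<in>{..<n}. ?K\<^sup>2 * (cmod (c v i))\<^sup>2 < (cmod (x + \<i> * complex_of_real (e i)))\<^sup>2 * (cmod (c v i))\<^sup>2"
      by (intro bexI[of _ i] mult_strict_right_mono lt) auto
  qed simp
  finally show False using ec[OF v(1), of x \<i>] fd[OF v(1), of 0 z] by (simp add: zv)
qed

section \<open>Square roots of positive semidefinite matrices: complex Hermitian, then real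
  symmetric\<close>

definition cpsd_mat :: "nat \<Rightarrow> complex mat \<Rightarrow> bool" where
  "cpsd_mat n A \<longleftrightarrow> hermitian_mat n A \<and> (\<forall>v\<in>carrier_vec n. 0 \<le> Re ((A *\<^sub>v v) \<bullet>c v))"

lemma sq_norm_add_scaled:
  assumes "u \<in> carrier_vec n" "v \<in> carrier_vec n"
  shows "sq_norm (u + complex_of_real r \<cdot>\<^sub>v v) = sq_norm u + 2 * r * Re (u \<bullet>c v) + r\<^sup>2 * sq_norm v"
proof -
  have "(cmod (a + of_real r * b))\<^sup>2 = (cmod a)\<^sup>2 + 2 * r * Re (a * cnj b) + r\<^sup>2 * (cmod b)\<^sup>2" for a b :: complex
    unfolding cmod_power2 by (simp add: power2_eq_square algebra_simps)
  then show ?thesis using assms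
    by (simp add: sq_norm_def scalar_prod_def atLeast0LessThan sum.distrib sum_distrib_left distrib_left)
qed

text \<open>If \<open>S v = T v + e v\<close> then \<open>S\<^sup>2 = T\<^sup>2\<close> forces
  \<open>\<langle>T v, v\<rangle> = - e \<bar>v\<bar>\<^sup>2 / 2\<close> and \<open>\<langle>S v, v\<rangle> = e \<bar>v\<bar>\<^sup>2 / 2\<close>, both of which are nonnegative.\<close>
lemma cpsd_sqrt_unique:
  assumes S: "cpsd_mat n S" and T: "cpsd_mat n T" and sq: "S * S = T * T"
  shows "S = T"
proof -
  have Sc: "S \<in> carrier_mat n n" "ctrans S = S" and Tc: "T \<in> carrier_mat n n" "ctrans T = T"
    using S T by (auto simp: cpsd_mat_def hermitian_mat_def)
  have D: "hermitian_mat n (S - T)"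
    unfolding hermitian_mat_def
  proof
    show "S - T \<in> carrier_mat n n" using Sc Tc by auto
    show "ctrans (S - T) = S - T"
      using hermitian_mat_index[of n S] hermitian_mat_index[of n T] S T Sc Tc
      by (intro eq_matI) (auto simp: cpsd_mat_def)
  qed
  obtain U e where U: "unitary_mat n U" and DU: "S - T = U * diag_of n (\<lambda>i. complex_of_real (e i)) * ctrans U"
    and ev: "\<And>i. i < n \<Longrightarrow> (S - T) *\<^sub>v col U i = complex_of_real (e i) \<cdot>\<^sub>v col U i"
    and nrm: "\<And>i. i < n \<Longrightarrow> sq_norm (col U i) = 1"
    using hermitian_mat_eigen_expansion[OF D] by metis
  have Uc: "U \<in> carrier_mat n n" using U by (simp add: unitary_mat_def)
  have nsq: "sq_norm (X *\<^sub>v v) = Re (v \<bullet>c ((X * X) *\<^sub>v v))" if "cpsd_mat n X" "v \<in> carrier_vec n" for X v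
  proof -
    have X: "X \<in> carrier_mat n n" "ctrans X = X" using that by (auto simp: cpsd_mat_def hermitian_mat_def)
    have "(X *\<^sub>v v) \<bullet>c (X *\<^sub>v v) = v \<bullet>c (ctrans X *\<^sub>v (X *\<^sub>v v))"
      using X that by (intro cscalar_prod_mult_mat_vec) auto
    also have "ctrans X *\<^sub>v (X *\<^sub>v v) = (X * X) *\<^sub>v v"
      using X that assoc_mult_mat_vec[of X n n X n v] by simp
    finally show ?thesis unfolding cscalar_self by (metis Re_complex_of_real)
  qed
  have e0: "e i = 0" if i: "i < n" for i
  proof -
    let ?v = "col U i"
    have v: "?v \<in> carrier_vec n" using Uc i by auto
    have Sv: "S *\<^sub>v ?v = T *\<^sub>v ?v + complex_of_real (e i) \<cdot>\<^sub>v ?v"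
      using ev[OF i, symmetric] minus_mult_distrib_mat_vec[OF Sc(1) Tc(1) v] Sc Tc v Uc
      by (intro eq_vecI) auto
    have Tv: "T *\<^sub>v ?v = S *\<^sub>v ?v + complex_of_real (- e i) \<cdot>\<^sub>v ?v"
      using Sc Tc v Uc by (intro eq_vecI) (auto simp: Sv)
    have Sn: "S *\<^sub>v ?v \<in> carrier_vec n" and Tn: "T *\<^sub>v ?v \<in> carrier_vec n" using Sc Tc v by auto
    have eq: "sq_norm (S *\<^sub>v ?v) = sq_norm (T *\<^sub>v ?v)" using nsq[OF S v] nsq[OF T v] sq by simp
    have pos: "0 \<le> Re ((S *\<^sub>v ?v) \<bullet>c ?v)" "0 \<le> Re ((T *\<^sub>v ?v) \<bullet>c ?v)" using S T v by (auto simp: cpsd_mat_def)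
    have 1: "sq_norm (S *\<^sub>v ?v) = sq_norm (T *\<^sub>v ?v) + 2 * e i * Re ((T *\<^sub>v ?v) \<bullet>c ?v) + (e i)\<^sup>2"
      using sq_norm_add_scaled[OF Tn v, of "e i"] nrm[OF i] by (simp flip: Sv)
    have 2: "sq_norm (T *\<^sub>v ?v) = sq_norm (S *\<^sub>v ?v) - 2 * e i * Re ((S *\<^sub>v ?v) \<bullet>c ?v) + (e i)\<^sup>2"
      using sq_norm_add_scaled[OF Sn v, of "- e i"] nrm[OF i] unfolding Tv[symmetric] by simp
    have 3: "e i * (2 * Re ((T *\<^sub>v ?v) \<bullet>c ?v) + e i) = 0" "e i * (e i - 2 * Re ((S *\<^sub>v ?v) \<bullet>c ?v)) = 0"
    proof -
      have "2 * e i * Re ((T *\<^sub>v ?v) \<bullet>c ?v) + (e i)\<^sup>2 = 0" "(e i)\<^sup>2 - 2 * e i * Re ((S *\<^sub>v ?v) \<bullet>c ?v) = 0"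
        using 1 2 eq by linarith+
      then show "e i * (2 * Re ((T *\<^sub>v ?v) \<bullet>c ?v) + e i) = 0" "e i * (e i - 2 * Re ((S *\<^sub>v ?v) \<bullet>c ?v)) = 0"
        unfolding power2_eq_square right_diff_distrib distrib_left by (simp_all only: mult_ac)
    qed
    show ?thesis
    proof (rule ccontr)
      assume "e i \<noteq> 0"
      with 3 have "2 * Re ((T *\<^sub>v ?v) \<bullet>c ?v) + e i = 0" "e i - 2 * Re ((S *\<^sub>v ?v) \<bullet>c ?v) = 0" by auto
      with pos \<open>e i \<noteq> 0\<close> show False by linarith
    qed
  qed
  have "diag_of n (\<lambda>i. complex_of_real (e i)) = 0\<^sub>m n n"
    using e0 by (intro eq_matI) (auto simp: diag_of_def)
  then have "S - T = 0\<^sub>m n n" unfolding DU using Uc by auto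
  show ?thesis
  proof (rule eq_matI)
    fix i j assume "i < dim_row T" "j < dim_col T"
    then show "S $$ (i, j) = T $$ (i, j)"
      using arg_cong[OF \<open>S - T = 0\<^sub>m n n\<close>, of "\<lambda>X. X $$ (i, j)"] Sc Tc by simp
  qed (use Sc Tc in auto)
qed

text \<open>The quadratic form at unit eigenvectors shows that the eigenvalues are nonnegative, so
  roots can be taken in the diagonal factor.\<close>

lemma cpsd_sqrt_exists:
  assumes M: "cpsd_mat n M"
  obtains S where "cpsd_mat n S" "S * S = M"
proof -
  have Mh: "hermitian_mat n M" using M by (simp add: cpsd_mat_def)
  obtain U e where U: "unitary_mat n U" and MU: "M = U * diag_of n (\<lambda>i. complex_of_real (e i)) * ctrans U"
    and ev: "\<And>i. i < n \<Longrightarrow> M *\<^sub>v col U i = complex_of_real (e i) \<cdot>\<^sub>v col U i"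
    and nrm: "\<And>i. i < n \<Longrightarrow> sq_norm (col U i) = 1"
    using hermitian_mat_eigen_expansion[OF Mh] by metis
  have Uc: "U \<in> carrier_mat n n" and UU: "ctrans U * U = 1\<^sub>m n" using U by (auto simp: unitary_mat_def)
  have e0: "0 \<le> e i" if i: "i < n" for i
  proof -
    have v: "col U i \<in> carrier_vec n" using Uc i by auto
    have "0 \<le> Re ((M *\<^sub>v col U i) \<bullet>c col U i)" using M v by (auto simp: cpsd_mat_def)
    also have "(M *\<^sub>v col U i) \<bullet>c col U i = complex_of_real (e i) * (col U i \<bullet>c col U i)"
      unfolding ev[OF i] using v by (subst smult_scalar_prod_distrib) auto
    finally show ?thesis by (simp add: cscalar_self nrm[OF i])
  qed
  define D where "D = diag_of n (\<lambda>i. complex_of_real (sqrt (e i)))"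
  have Dc: "D \<in> carrier_mat n n" by (simp add: D_def)
  define S where "S = U * D * ctrans U"
  have "hermitian_mat n D"
    by (auto simp: hermitian_mat_def D_def diag_of_def intro!: eq_matI)
  then have Sh: "hermitian_mat n S"
    unfolding S_def using hermitian_mat_congruence[of n D "ctrans U" n] Uc by simp
  have "0 \<le> Re ((S *\<^sub>v v) \<bullet>c v)" if v: "v \<in> carrier_vec n" for v
  proof -
    let ?w = "ctrans U *\<^sub>v v"
    have w: "?w \<in> carrier_vec n" and Dw: "D *\<^sub>v ?w \<in> carrier_vec n" using Uc v Dc by auto
    have "S *\<^sub>v v = U *\<^sub>v (D *\<^sub>v ?w)"
      unfolding S_def using Uc Dc v w
      by (simp add: assoc_mult_mat_vec[of _ n n _ n])
    then have "(S *\<^sub>v v) \<bullet>c v = (D *\<^sub>v ?w) \<bullet>c ?w"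
      using cscalar_prod_mult_mat_vec[OF Uc Dw v] by simp
    also have "\<dots> = (\<Sum>i<n. of_real (sqrt (e i)) * (?w $ i * cnj (?w $ i)))"
    proof -
      have "D *\<^sub>v ?w = vec n (\<lambda>i. of_real (sqrt (e i)) * ?w $ i)"
        unfolding D_def by (rule diag_of_mult_vec[OF w])
      moreover have "dim_vec ?w = n" using w by (rule carrier_vecD)
      ultimately show ?thesis
        unfolding scalar_prod_def by (auto simp: atLeast0LessThan mult.assoc intro!: sum.cong)
    qed
    finally have "Re ((S *\<^sub>v v) \<bullet>c v) = (\<Sum>i<n. sqrt (e i) * (cmod (?w $ i))\<^sup>2)"
      by (simp only: complex_norm_square[symmetric] of_real_mult[symmetric] of_real_sum[symmetric] Re_complex_of_real)
    also have "\<dots> \<ge> 0" using e0 by (intro sum_nonneg mult_nonneg_nonneg) auto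
    finally show ?thesis .
  qed
  then have "cpsd_mat n S" using Sh by (simp add: cpsd_mat_def)
  moreover have "S * S = M"
  proof -
    have "S * S = U * D * (ctrans U * U) * D * ctrans U"
      unfolding S_def using Uc Dc by (simp add: assoc_mult_mat[of _ n n _ n _ n])
    also have "\<dots> = U * (D * D) * ctrans U"
      using Uc Dc by (simp add: UU assoc_mult_mat[of _ n n _ n _ n])
    also have "D * D = diag_of n (\<lambda>i. complex_of_real (e i))"
      using e0 unfolding D_def diag_of_mult
      by (intro eq_matI) (auto simp: diag_of_def simp flip: of_real_mult)
    finally show ?thesis by (simp add: MU)
  qed
  ultimately show thesis using that by blast
qed

lemma cmat_mult: "A \<in> carrier_mat n m \<Longrightarrow> B \<in> carrier_mat m k \<Longrightarrow> cmat (A * B) = cmat A * cmat B"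
  by (rule of_real_hom.mat_hom_mult)

lemma cmat_inject: "cmat A = cmat B \<longleftrightarrow> A = B"
  by (auto simp: mat_eq_iff)

lemma sym_mat_index: "sym_mat N M \<Longrightarrow> i < N \<Longrightarrow> j < N \<Longrightarrow> M $$ (j, i) = M $$ (i, j)"
  unfolding sym_mat_def by (metis carrier_matD index_transpose_mat(1))

lemma hermitian_cmat: "sym_mat N M \<Longrightarrow> hermitian_mat N (cmat M)"
  using sym_mat_index[of N M]
  by (auto simp: hermitian_mat_def sym_mat_def intro!: eq_matI)

text \<open>Splitting v into real and imaginary parts reduces the complex quadratic form to two real
  ones, which carries positivity from real to complex vectors.\<close>

lemma Re_cscalar_cmat:
  assumes M: "sym_mat N M" and v: "v \<in> carrier_vec N"
  defines "x \<equiv> map_vec Re v" and "y \<equiv> map_vec Im v"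
  shows "Re ((cmat M *\<^sub>v v) \<bullet>c v) = x \<bullet> (M *\<^sub>v x) + y \<bullet> (M *\<^sub>v y)"
proof -
  have Mc: "M \<in> carrier_mat N N" using M by (simp add: sym_mat_def)
  have "(cmat M *\<^sub>v v) \<bullet>c v = (\<Sum>i<N. \<Sum>j<N. of_real (M $$ (i, j)) * v $ j * cnj (v $ i))"
    using Mc v by (auto simp: scalar_prod_def sum_distrib_right atLeast0LessThan intro!: sum.cong)
  then have "Re ((cmat M *\<^sub>v v) \<bullet>c v) =
     (\<Sum>i<N. \<Sum>j<N. M $$ (i, j) * Re (v $ j) * Re (v $ i) + M $$ (i, j) * Im (v $ j) * Im (v $ i))"
    by (simp add: algebra_simps)
  also have "\<dots> = x \<bullet> (M *\<^sub>v x) + y \<bullet> (M *\<^sub>v y)"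
    using Mc v
    by (simp add: x_def y_def scalar_prod_def sum.distrib sum_distrib_left sum_distrib_right atLeast0LessThan mult_ac)
  finally show ?thesis .
qed

lemma cpsd_cmat: "cpsd_mat N (cmat M) \<longleftrightarrow> psd_mat N M"
proof
  assume M: "psd_mat N M"
  then have sym: "sym_mat N M" by (simp add: psd_mat_def)
  show "cpsd_mat N (cmat M)"
    unfolding cpsd_mat_def
    using hermitian_cmat[OF sym] Re_cscalar_cmat[OF sym] M by (auto simp: psd_mat_def)
next
  assume M: "cpsd_mat N (cmat M)"
  then have Mc: "M \<in> carrier_mat N N" by (simp add: cpsd_mat_def hermitian_mat_def)
  have sym: "sym_mat N M"
    unfolding sym_mat_def using Mc hermitian_mat_index[of N "cmat M"] M
    by (auto simp: cpsd_mat_def intro!: eq_matI)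
  have "0 \<le> v \<bullet> (M *\<^sub>v v)" if v: "v \<in> carrier_vec N" for v
  proof -
    let ?v = "map_vec complex_of_real v"
    have v': "?v \<in> carrier_vec N" using v by simp
    have "map_vec Re ?v = v" "map_vec Im ?v = 0\<^sub>v N" using v by (auto intro!: eq_vecI)
    then have "Re ((cmat M *\<^sub>v ?v) \<bullet>c ?v) = v \<bullet> (M *\<^sub>v v)"
      using Re_cscalar_cmat[OF sym v'] Mc v by (simp add: scalar_prod_left_zero[of _ N])
    moreover have "0 \<le> Re ((cmat M *\<^sub>v ?v) \<bullet>c ?v)" using M v' unfolding cpsd_mat_def by blast
    ultimately show ?thesis by simp
  qed
  then show "psd_mat N M" using sym by (simp add: psd_mat_def)
qed

text \<open>The entrywise conjugate of a complex root of a real matrix is again a positive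
  semidefinite root, so uniqueness forces the root to be real.\<close>

lemma psd_sqrt_exists:
  assumes M: "psd_mat N M"
  obtains S where "psd_mat N S" "S * S = M"
proof -
  have Mc: "M \<in> carrier_mat N N" using M by (simp add: psd_mat_def sym_mat_def)
  obtain S where S: "cpsd_mat N S" and SS: "S * S = cmat M"
    using cpsd_sqrt_exists[of N "cmat M"] M by (auto simp: cpsd_cmat)
  have Sc: "S \<in> carrier_mat N N" using S by (simp add: cpsd_mat_def hermitian_mat_def)
  let ?S = "map_mat cnj S"
  have "cpsd_mat N ?S"
    unfolding cpsd_mat_def
  proof (intro conjI ballI)
    show "hermitian_mat N ?S"
      using S hermitian_mat_index[of N S] by (auto simp: cpsd_mat_def hermitian_mat_def intro!: eq_matI)
    fix v :: "complex vec" assume v: "v \<in> carrier_vec N"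
    let ?w = "map_vec cnj v"
    have w: "?w \<in> carrier_vec N" and vw: "v = map_vec cnj ?w" using v by auto
    have "?S *\<^sub>v v = map_vec cnj (S *\<^sub>v ?w)"
      by (subst vw, rule cnj_hom.mult_mat_vec_hom[OF Sc w, symmetric])
    moreover have "map_vec cnj a \<bullet>c v = cnj (a \<bullet>c ?w)" if "a \<in> carrier_vec N" for a
      using that v by (simp add: scalar_prod_def)
    ultimately have "(?S *\<^sub>v v) \<bullet>c v = cnj ((S *\<^sub>v ?w) \<bullet>c ?w)" using Sc w by auto
    then show "0 \<le> Re ((?S *\<^sub>v v) \<bullet>c v)" using S w by (auto simp: cpsd_mat_def)
  qed
  moreover have "?S * ?S = S * S"
  proof -
    have "?S * ?S = map_mat cnj (S * S)" using cnj_hom.mat_hom_mult[OF Sc Sc] by simp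
    also have "\<dots> = S * S" unfolding SS by (intro eq_matI) auto
    finally show ?thesis .
  qed
  ultimately have real: "?S = S" using cpsd_sqrt_unique S by blast
  have "cnj (S $$ (i, j)) = S $$ (i, j)" if "i < N" "j < N" for i j
    using arg_cong[OF real, of "\<lambda>X. X $$ (i, j)"] that Sc by auto
  then have Seq: "S = cmat (map_mat Re S)"
    using Sc by (intro eq_matI) (auto simp: complex_eq_iff)
  have "psd_mat N (map_mat Re S)" using S Seq cpsd_cmat by metis
  moreover have "map_mat Re S * map_mat Re S = M"
  proof -
    have "cmat (map_mat Re S * map_mat Re S) = S * S"
      using Sc by (subst cmat_mult[of _ N N _ N]) (auto simp flip: Seq)
    then show ?thesis using SS cmat_inject by metis
  qed
  ultimately show thesis using that by blast
qed

text \<open>Existence and uniqueness together discharge the definite description behind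
  \<open>sqrt_mat\<close>.\<close>

lemma sqrt_mat:
  assumes M: "psd_mat N M"
  shows "psd_mat N (sqrt_mat M)" "sqrt_mat M * sqrt_mat M = M"
proof -
  have N: "dim_row M = N" using M by (auto simp: psd_mat_def sym_mat_def)
  obtain S where S: "psd_mat N S" "S * S = M" using psd_sqrt_exists[OF M] .
  have unique: "T = S" if T: "psd_mat N T" "T * T = M" for T
  proof -
    have c: "T \<in> carrier_mat N N" "S \<in> carrier_mat N N" using S T by (auto simp: psd_mat_def sym_mat_def)
    have "cmat T * cmat T = cmat S * cmat S"
      using cmat_mult[OF c(1) c(1)] cmat_mult[OF c(2) c(2)] S(2) T(2) by simp
    then show ?thesis using cpsd_sqrt_unique[of N "cmat T" "cmat S"] S T by (simp add: cpsd_cmat cmat_inject)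
  qed
  have "psd_mat N (sqrt_mat M) \<and> sqrt_mat M * sqrt_mat M = M"
    unfolding sqrt_mat_def N
    using theI[of "\<lambda>S. psd_mat N S \<and> S * S = M" S] S unique by blast
  then show "psd_mat N (sqrt_mat M)" "sqrt_mat M * sqrt_mat M = M" by auto
qed

text \<open>A kernel vector of the root would be a kernel vector of \<alpha>, so the root is
  invertible and \<open>mat_inverse\<close> returns \<open>Some\<close>. The inverse is symmetric
  because its transpose also inverts the symmetric root.\<close>

lemma inv_sqrt_mat_sym:
  assumes \<alpha>: "pd_mat N \<alpha>"
  shows "sym_mat N (inv_sqrt_mat \<alpha>)"
proof -
  have "psd_mat N \<alpha>"
  proof -
    have "0 \<le> v \<bullet> (\<alpha> *\<^sub>v v)" if "v \<in> carrier_vec N" for v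
      using \<alpha> that by (cases "v = 0\<^sub>v N") (auto simp: pd_mat_def sym_mat_def less_imp_le)
    then show ?thesis using \<alpha> by (auto simp: psd_mat_def pd_mat_def)
  qed
  note sq = sqrt_mat[OF this]
  define S where "S = sqrt_mat \<alpha>"
  have Sc: "S \<in> carrier_mat N N" and St: "transpose_mat S = S" and SS: "S * S = \<alpha>"
    using sq by (auto simp: S_def psd_mat_def sym_mat_def)
  have "det S \<noteq> 0"
  proof
    assume "det S = 0"
    then obtain v where v: "v \<in> carrier_vec N" "v \<noteq> 0\<^sub>v N" "S *\<^sub>v v = 0\<^sub>v N"
      using det_0_iff_vec_prod_zero[OF Sc] by blast
    have "\<alpha> *\<^sub>v v = S *\<^sub>v (S *\<^sub>v v)" using assoc_mult_mat_vec[OF Sc Sc v(1)] SS by simp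
    also have "\<dots> = 0\<^sub>v N" unfolding v(3) using Sc by auto
    finally show False using \<alpha> v by (auto simp: pd_mat_def)
  qed
  then have "S \<in> Units (ring_mat TYPE(real) N ())" by (rule det_non_zero_imp_unit[OF Sc])
  then obtain Z where Z: "mat_inverse S = Some Z" using mat_inverse(1)[OF Sc, of "()"] by (cases "mat_inverse S") auto
  note inv = mat_inverse(2)[OF Sc Z]
  then have Zc: "Z \<in> carrier_mat N N" by simp
  have "transpose_mat Z * S = 1\<^sub>m N"
    using inv transpose_mult[OF Sc Zc] St by simp
  then have "transpose_mat Z = Z"
    using inv Sc Zc assoc_mult_mat[of "transpose_mat Z" N N S N Z N] by simp
  then show ?thesis using Zc by (simp add: sym_mat_def inv_sqrt_mat_def Z flip: S_def)
qed

section \<open>High-loss eigenvalues of a Hermitian pencil\<close>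

text \<open>The determinant is homogeneous of degree n. Applied with c = -i, since M(0) = -i B, and
  with c = beta, since A(beta) = beta M(1/beta).\<close>

lemma char_poly_smult_mat:
  fixes X :: "complex mat"
  assumes X: "X \<in> carrier_mat n n"
  shows "poly (char_poly (c \<cdot>\<^sub>m X)) (c * x) = c ^ n * poly (char_poly X) x"
proof -
  have "- char_matrix (c \<cdot>\<^sub>m X) (c * x) = c \<cdot>\<^sub>m (- char_matrix X x)"
    using X by (intro eq_matI) (auto simp: char_matrix_def algebra_simps)
  moreover have "- char_matrix X x \<in> carrier_mat n n" using X by simp
  ultimately show ?thesis
    using X det_smult[of c "- char_matrix X x"] by (simp add: char_poly_matrix[of _ n] char_matrix_def del: det_smult)
qed

text \<open>The preceding identity, read between polynomials and differentiated in x; for c \<noteq>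
  0 it carries simplicity of a root across the scaling.\<close>

lemma pderiv_char_poly_smult_mat:
  fixes X :: "complex mat"
  assumes X: "X \<in> carrier_mat n n"
  shows "c * poly (pderiv (char_poly (c \<cdot>\<^sub>m X))) (c * x) = c ^ n * poly (pderiv (char_poly X)) x"
proof -
  have "pcompose (char_poly (c \<cdot>\<^sub>m X)) [:0, c:] = Polynomial.smult (c ^ n) (char_poly X)"
    by (rule poly_ext) (use char_poly_smult_mat[OF X, of c] in \<open>simp add: poly_pcompose mult.commute\<close>)
  from arg_cong[OF this, of "\<lambda>p. poly (pderiv p) x"] show ?thesis
    by (simp add: pderiv_pcompose poly_pcompose pderiv_smult pderiv_pCons mult.commute)
qed

lemma eigenvalue_smult_mat:
  fixes X :: "complex mat"
  assumes "X \<in> carrier_mat n n" "eigenvalue X x"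
  shows "eigenvalue (c \<cdot>\<^sub>m X) (c * x)"
  using assms char_poly_smult_mat[of X n c x]
  by (simp add: eigenvalue_root_char_poly[of _ n])

lemma order_eq_1_if_simple_root:
  fixes p :: "complex poly"
  assumes "poly p a = 0" "poly (pderiv p) a \<noteq> 0"
  shows "Polynomial.order a p = 1"
proof -
  have "p \<noteq> 0" "pderiv p \<noteq> 0" using assms by auto
  then have "Polynomial.order a p \<noteq> 0" using assms by (simp add: order_root)
  then have "Polynomial.order a p = Suc (Polynomial.order a (pderiv p))"
    using \<open>pderiv p \<noteq> 0\<close> assms(1) by (intro order_pderiv) auto
  moreover have "Polynomial.order a (pderiv p) = 0"
    using assms(2) order_root[of "pderiv p" a] by auto
  ultimately show ?thesis by simp
qed

lemma prod_linear_dvd: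
  fixes p :: "complex poly"
  assumes "finite J" "inj_on w J" "\<And>j. j \<in> J \<Longrightarrow> poly p (w j) = 0"
  shows "(\<Prod>j\<in>J. [:- w j, 1:]) dvd p"
  using assms
proof (induction J rule: finite_induct)
  case empty
  then show ?case by simp
next
  case (insert i J)
  then obtain q where q: "p = (\<Prod>j\<in>J. [:- w j, 1:]) * q" by (auto simp: dvd_def)
  have "poly (\<Prod>j\<in>J. [:- w j, 1:]) (w i) \<noteq> 0"
    using insert by (auto simp: poly_prod)
  moreover have "poly p (w i) = 0" using insert by simp
  ultimately have "poly q (w i) = 0" unfolding q by simp
  then obtain s where "q = [:- w i, 1:] * s" by (auto simp: poly_eq_0_iff_dvd)
  then have "p = ([:- w i, 1:] * (\<Prod>j\<in>J. [:- w j, 1:])) * s" unfolding q by (simp only: mult_ac)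
  then show ?case using insert by simp
qed

lemma poly_pderiv_linear_mult:
  fixes q :: "complex poly"
  shows "poly (pderiv ([:- a, 1:] * q)) a = poly q a"
  unfolding pderiv_mult by (simp add: pderiv_pCons)

text \<open>In the application the radius may be infinite: \<omega> = 0 gives
  \<open>inverse 0\<close>, which is \<infinity> in \<open>ereal\<close>, and the disc is the whole
  plane.\<close>

lemma convex_eball_0: "convex (eball (0 :: complex) r)"
proof (cases r)
  case (real r')
  then show ?thesis by simp
qed (auto simp: eball_def)

text \<open>The block structure and the matrices \<alpha>, \<eta>, \<theta>, R enter the
  perturbation argument through these assumptions alone. The two conjugation conditions make the
  spectrum of M(z) symmetric about the imaginary axis for real z.\<close>

locale pencil =
  fixes n m :: nat and \<Omega> B :: "complex mat" and \<omega> :: real and b :: "nat \<Rightarrow> real"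
  assumes \<Omega>: "hermitian_mat n \<Omega>" "map_mat cnj \<Omega> = - \<Omega>"
    and B: "hermitian_mat n B" "map_mat cnj B = B"
    and \<omega>: "\<And>t. eigenvalue \<Omega> (complex_of_real t) \<Longrightarrow> \<bar>t\<bar> \<le> \<omega>" "0 \<le> \<omega>"
    and b: "nonzero_eigenvalues B m b" "inj_on b {1..m}" and m: "m > 0"
begin

abbreviation d :: real where "d \<equiv> gap m b"

definition U :: "complex set" where "U = eball 0 (inverse (ereal (2 * \<omega> / d)))"

definition M :: "complex \<Rightarrow> complex mat" where "M z = z \<cdot>\<^sub>m \<Omega> - \<i> \<cdot>\<^sub>m B"

text \<open>For j >= 1 the eigenvalues of M(0) = -i B that are followed; c_0 = 0 is the centre near
  which the bounded eigenvalues lie after division by beta.\<close>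

definition c :: "nat \<Rightarrow> complex" where "c j = - \<i> * of_real (b j)"

lemma carrier: "\<Omega> \<in> carrier_mat n n" "B \<in> carrier_mat n n" "M z \<in> carrier_mat n n"
  using \<Omega> B by (auto simp: hermitian_mat_def M_def)

lemma b_0: "b 0 = 0" and b_pos: "k \<in> {1..m} \<Longrightarrow> 0 < b k"
  using b(1) unfolding nonzero_eigenvalues_def by blast+

section \<open>Spectral gap and localization of the roots\<close>

lemma gap_pos: "0 < d" and gap_le: "i \<le> m \<Longrightarrow> j \<le> m \<Longrightarrow> i \<noteq> j \<Longrightarrow> d \<le> \<bar>b i - b j\<bar>"
proof -
  let ?S = "{\<bar>b i - b j\<bar> | i j. i \<le> m \<and> j \<le> m \<and> i \<noteq> j}"
  have inj: "b i \<noteq> b j" if ij: "i \<le> m" "j \<le> m" "i \<noteq> j" for i j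
  proof (cases "i = 0 \<or> j = 0")
    case True
    then consider "i = 0" "j \<in> {1..m}" | "j = 0" "i \<in> {1..m}" using ij by force
    then show ?thesis using b_pos[of i] b_pos[of j] b_0 by cases auto
  next
    case False
    then show ?thesis using inj_onD[OF b(2), of i j] ij by auto
  qed
  have "?S \<subseteq> (\<lambda>(i, j). \<bar>b i - b j\<bar>) ` ({..m} \<times> {..m})" by auto
  then have fin: "finite ?S" by (rule finite_subset) simp
  \<comment> \<open>m > 0 makes the set nonempty, so the minimum is attained and is the distance of
    two distinct values.\<close>
  have "\<bar>b 0 - b 1\<bar> \<in> ?S" using m by force
  then have "Min ?S \<in> ?S" by (intro Min_in[OF fin]) blast
  then obtain k l where "d = \<bar>b k - b l\<bar>" "k \<le> m" "l \<le> m" "k \<noteq> l"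
    unfolding gap_def by blast
  then show "0 < d" using inj[of k l] by simp
  show "d \<le> \<bar>b i - b j\<bar>" if "i \<le> m" "j \<le> m" "i \<noteq> j"
    unfolding gap_def using that by (intro Min_le[OF fin]) blast
qed

lemma dist_c: "dist (c i) (c j) = \<bar>b i - b j\<bar>"
proof -
  have "c i - c j = - \<i> * of_real (b i - b j)" by (simp add: c_def algebra_simps)
  then show ?thesis unfolding dist_norm by (simp only: norm_mult norm_of_real) simp
qed

lemma open_U: "open U" and convex_U: "convex U" and zero_in_U: "0 \<in> U"
proof -
  show "open U" "convex U" by (auto simp: U_def convex_eball_0)
  have "0 < inverse (ereal (2 * \<omega> / d))" using \<omega>(2) gap_pos by (cases "\<omega> = 0") auto
  then show "0 \<in> U" by (simp add: U_def zero_ereal_def)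
qed

text \<open>Clearing the denominator also settles the infinite radius: for \<omega> = 0 both sides
  hold everywhere.\<close>

lemma in_U_iff: "z \<in> U \<longleftrightarrow> cmod z * \<omega> < d / 2"
proof (cases "\<omega> = 0")
  case True
  then show ?thesis using gap_pos unfolding U_def by (simp add: eball_def)
next
  case False
  then have "0 < \<omega>" using \<omega>(2) by simp
  then show ?thesis using gap_pos by (simp add: U_def field_simps)
qed

text \<open>The eigenvalue 0 is covered by the index k = 0.\<close>

lemma eigenvalue_B: "eigenvalue B (complex_of_real t) \<Longrightarrow> \<exists>k\<le>m. t = b k"
proof -
  assume "eigenvalue B (complex_of_real t)"
  then have "poly (char_poly B) (complex_of_real t) = 0"
    by (simp add: eigenvalue_root_char_poly[OF carrier(2)])
  then have "(\<exists>k\<in>{1..m}. t = b k) \<or> t = 0"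
    using b(1) unfolding nonzero_eigenvalues_def
    by (auto simp: poly_prod poly_power)
  then show ?thesis using b(1) unfolding nonzero_eigenvalues_def by (metis atLeastAtMost_iff zero_le)
qed

lemma root_near_c:
  assumes "poly (char_poly (M z)) x = 0"
  obtains k where "k \<le> m" "dist (c k) x \<le> cmod z * \<omega>"
proof -
  have "eigenvalue (M z) x" using assms by (simp add: eigenvalue_root_char_poly[OF carrier(3)])
  then obtain t where t: "eigenvalue B (complex_of_real t)" "cmod (x + \<i> * t) \<le> cmod z * \<omega>"
    using eigenvalue_perturbation[OF B(1) \<Omega>(1) \<omega>(1)] unfolding M_def by blast
  then obtain k where "k \<le> m" "t = b k" using eigenvalue_B by blast
  then show thesis using that[of k] t(2) by (simp add: dist_norm c_def norm_minus_commute)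
qed

lemma root_in_unique_disc:
  assumes z: "z \<in> U" and x: "dist (c j) x \<le> d / 2" and j: "j \<le> m" and k: "k \<le> m" "dist (c k) x \<le> cmod z * \<omega>"
  shows "k = j"
proof (rule ccontr)
  assume "k \<noteq> j"
  then have "d \<le> dist (c k) (c j)" using gap_le[OF k(1) j] by (simp add: dist_c)
  also have "\<dots> \<le> dist (c k) x + dist (c j) x" by (rule dist_triangle2)
  also have "\<dots> < d / 2 + d / 2" using x k(2) z by (simp add: in_U_iff)
  finally show False by simp
qed

text \<open>The entries are those of -i B + z \<Omega> as polynomials in z; forming the
  characteristic polynomial before inserting z makes the dependence on z polynomial.\<close>

definition C :: "complex poly poly" where
  "C = char_poly (mat n n (\<lambda>(i, j). [:- \<i> * B $$ (i, j), \<Omega> $$ (i, j):]))"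

lemma specialize_C: "specialize C z = char_poly (M z)"
proof -
  have "map_mat (\<lambda>q. poly q z) (mat n n (\<lambda>(i, j). [:- \<i> * B $$ (i, j), \<Omega> $$ (i, j):])) = M z"
    using carrier by (intro eq_matI) (auto simp: M_def)
  then show ?thesis
    unfolding C_def
    using poly_hom.char_poly_hom[of "mat n n (\<lambda>(i, j). [:- \<i> * B $$ (i, j), \<Omega> $$ (i, j):])" n z] by auto
qed

lemma char_poly_nonzero_on_sphere:
  assumes "z \<in> U" "j \<le> m" "x \<in> sphere (c j) (d / 2)"
  shows "poly (char_poly (M z)) x \<noteq> 0"
proof
  assume "poly (char_poly (M z)) x = 0"
  then obtain k where k: "k \<le> m" "dist (c k) x \<le> cmod z * \<omega>" by (rule root_near_c)
  have "k = j" using root_in_unique_disc[OF assms(1) _ assms(2) k] assms(3) by simp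
  then show False using k(2) assms by (simp add: in_U_iff)
qed

text \<open>M(0) = -i B scales the spectrum of \<open>B\<close>, and b_j is a root of just one
  factor of the characteristic polynomial because the b_k are distinct and positive.\<close>

lemma simple_root_at_0:
  assumes j: "j \<in> {1..m}"
  shows "simple_root_in (char_poly (M 0)) (ball (c j) (d / 2)) (c j)"
proof -
  have M0: "M 0 = - \<i> \<cdot>\<^sub>m B" using carrier by (intro eq_matI) (auto simp: M_def)
  have bj: "0 < b j" by (rule b_pos[OF j])
  let ?q = "(\<Prod>k\<in>{1..m} - {j}. [:- complex_of_real (b k), 1:]) * [:0, 1:] ^ (dim_row B - m)"
  have cp: "char_poly B = [:- complex_of_real (b j), 1:] * ?q"
  proof -
    have "char_poly B = (\<Prod>k=1..m. [:- complex_of_real (b k), 1:]) * [:0, 1:] ^ (dim_row B - m)"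
      using b(1) unfolding nonzero_eigenvalues_def by blast
    then show ?thesis
      using prod.remove[of "{1..m}" j "\<lambda>k. [:- complex_of_real (b k), 1:]"] j
      by (simp only: mult.assoc finite_atLeastAtMost)
  qed
  have "poly ?q (complex_of_real (b j)) \<noteq> 0"
  proof -
    have "b j - b k \<noteq> 0" if "k \<in> {1..m} - {j}" for k
      using inj_onD[OF b(2), of k j] that j by auto
    then show ?thesis using bj by (fastforce simp: poly_prod poly_power)
  qed
  then have B: "poly (char_poly B) (of_real (b j)) = 0" "poly (pderiv (char_poly B)) (of_real (b j)) \<noteq> 0"
    unfolding cp poly_pderiv_linear_mult poly_mult by simp_all
  have "poly (char_poly (M 0)) (c j) = 0"
    using char_poly_smult_mat[OF carrier(2), of "- \<i>" "of_real (b j)"]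
    unfolding M0 c_def by (simp only: B(1) mult_zero_right)
  moreover have "poly (pderiv (char_poly (M 0))) (c j) \<noteq> 0"
  proof
    assume "poly (pderiv (char_poly (M 0))) (c j) = 0"
    then have "(- \<i>) ^ n * poly (pderiv (char_poly B)) (of_real (b j)) = 0"
      using pderiv_char_poly_smult_mat[OF carrier(2), of "- \<i>" "of_real (b j)"]
      unfolding M0 c_def by (simp only: mult_zero_right)
    then show False using B(2) by simp
  qed
  \<comment> \<open>At z = 0 the localization radius |z| \<omega> is 0, so a root in the disc is its
    centre.\<close>
  moreover have "x = c j" if "x \<in> ball (c j) (d / 2)" "poly (char_poly (M 0)) x = 0" for x
  proof -
    obtain k where k: "k \<le> m" "dist (c k) x \<le> cmod 0 * \<omega>" using root_near_c[OF \<open>poly (char_poly (M 0)) x = 0\<close>] .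
    then have "k = j" using root_in_unique_disc[OF zero_in_U _ _ k, of j] that j by simp
    then show ?thesis using k(2) by simp
  qed
  moreover have "c j \<in> ball (c j) (d / 2)" using gap_pos by simp
  ultimately show ?thesis unfolding simple_root_in_def by blast
qed

section \<open>Analytic branches of the eigenvalues of M(z)\<close>

lemma analytic_eigenvalue_exists:
  assumes j: "j \<in> {1..m}"
  shows "\<exists>\<mu>. \<mu> holomorphic_on U \<and> (\<forall>z\<in>U. simple_root_in (char_poly (M z)) (ball (c j) (d / 2)) (\<mu> z))"
proof -
  obtain \<mu> where "\<mu> holomorphic_on U" "\<And>z. z \<in> U \<Longrightarrow> simple_root_in (specialize C z) (ball (c j) (d / 2)) (\<mu> z)"
  proof (rule holomorphic_simple_root[OF open_U convex_U zero_in_U])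
    show "d / 2 > 0" using gap_pos by simp
    show "monic (specialize C z)" for z
      unfolding specialize_C using degree_monic_char_poly[OF carrier(3)] by simp
    show "poly (specialize C z) x \<noteq> 0" if "z \<in> U" "x \<in> sphere (c j) (d / 2)" for z x
      unfolding specialize_C using char_poly_nonzero_on_sphere that j by auto
    show "simple_root_in (specialize C 0) (ball (c j) (d / 2)) (c j)"
      unfolding specialize_C by (rule simple_root_at_0[OF j])
  qed blast
  then show ?thesis by (auto simp: specialize_C)
qed

definition \<mu> :: "nat \<Rightarrow> complex \<Rightarrow> complex" where
  "\<mu> j = (SOME f. f holomorphic_on U \<and> (\<forall>z\<in>U. simple_root_in (char_poly (M z)) (ball (c j) (d / 2)) (f z)))"

lemma \<mu>_holomorphic: "j \<in> {1..m} \<Longrightarrow> \<mu> j holomorphic_on U"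
  and \<mu>_simple_root: "j \<in> {1..m} \<Longrightarrow> z \<in> U \<Longrightarrow> simple_root_in (char_poly (M z)) (ball (c j) (d / 2)) (\<mu> j z)"
  using someI_ex[OF analytic_eigenvalue_exists[of j]] unfolding \<mu>_def by auto

lemma \<mu>_root: "j \<in> {1..m} \<Longrightarrow> z \<in> U \<Longrightarrow> poly (char_poly (M z)) (\<mu> j z) = 0"
  and \<mu>_simple: "j \<in> {1..m} \<Longrightarrow> z \<in> U \<Longrightarrow> poly (pderiv (char_poly (M z))) (\<mu> j z) \<noteq> 0"
  and \<mu>_ball: "j \<in> {1..m} \<Longrightarrow> z \<in> U \<Longrightarrow> dist (c j) (\<mu> j z) < d / 2"
  and \<mu>_unique: "j \<in> {1..m} \<Longrightarrow> z \<in> U \<Longrightarrow> dist (c j) x < d / 2 \<Longrightarrow> poly (char_poly (M z)) x = 0 \<Longrightarrow> x = \<mu> j z"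
  using \<mu>_simple_root[of j z] unfolding simple_root_in_def by auto

text \<open>Sharpens the radius d / 2 to |z| \<omega>; multiplied by beta, this becomes the bounded
  error in the expansion of zeta_j.\<close>

lemma \<mu>_near: "j \<in> {1..m} \<Longrightarrow> z \<in> U \<Longrightarrow> dist (c j) (\<mu> j z) \<le> cmod z * \<omega>"
proof -
  assume j: "j \<in> {1..m}" and z: "z \<in> U"
  obtain k where k: "k \<le> m" "dist (c k) (\<mu> j z) \<le> cmod z * \<omega>" using root_near_c[OF \<mu>_root[OF j z]] .
  then have "k = j" using root_in_unique_disc[OF z _ _ k, of j] \<mu>_ball[OF j z] j by simp
  then show ?thesis using k by simp
qed

lemma \<mu>_inj: "z \<in> U \<Longrightarrow> inj_on (\<lambda>j. \<mu> j z) {1..m}"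
proof (rule inj_onI)
  fix i j assume z: "z \<in> U" and ij: "i \<in> {1..m}" "j \<in> {1..m}" and eq: "\<mu> i z = \<mu> j z"
  have "dist (c i) (\<mu> j z) \<le> cmod z * \<omega>" using \<mu>_near[OF ij(1) z] eq by simp
  moreover have "dist (c j) (\<mu> j z) \<le> d / 2" using \<mu>_ball[OF ij(2) z] by simp
  ultimately show "i = j" using root_in_unique_disc[OF z, of j "\<mu> j z" i] ij by simp
qed

lemma \<mu>_imaginary:
  assumes j: "j \<in> {1..m}" and z: "complex_of_real t \<in> U"
  shows "Re (\<mu> j (of_real t)) = 0"
proof -
  let ?z = "complex_of_real t" and ?x = "- cnj (\<mu> j (of_real t))"
  \<comment> \<open>For real z both z \<Omega> and -i B are purely imaginary, so conjugation negates
    the matrix.\<close>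
  have Mc: "map_mat cnj (M ?z) = -1 \<cdot>\<^sub>m M ?z"
  proof (rule eq_matI)
    fix i k assume "i < dim_row (-1 \<cdot>\<^sub>m M ?z)" "k < dim_col (-1 \<cdot>\<^sub>m M ?z)"
    then have ik: "i < n" "k < n" using carrier(3)[of ?z] by auto
    have "cnj (\<Omega> $$ (i, k)) = - \<Omega> $$ (i, k)" "cnj (B $$ (i, k)) = B $$ (i, k)"
      using arg_cong[OF \<Omega>(2), of "\<lambda>X. X $$ (i, k)"] arg_cong[OF B(2), of "\<lambda>X. X $$ (i, k)"] ik carrier
      by auto
    then show "map_mat cnj (M ?z) $$ (i, k) = (-1 \<cdot>\<^sub>m M ?z) $$ (i, k)"
      using ik carrier by (simp add: M_def)
  qed auto
  have "eigenvalue (M ?z) (\<mu> j ?z)" using \<mu>_root[OF j z] by (simp add: eigenvalue_root_char_poly[OF carrier(3)])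
  then have "eigenvalue (map_mat cnj (M ?z)) (cnj (\<mu> j ?z))"
    by (rule cnj_hom.eigenvalue_hom[OF carrier(3)])
  then have "eigenvalue (-1 \<cdot>\<^sub>m (-1 \<cdot>\<^sub>m M ?z)) (-1 * cnj (\<mu> j ?z))"
    unfolding Mc using carrier(3) by (intro eigenvalue_smult_mat[of _ n]) auto
  moreover have "-1 \<cdot>\<^sub>m (-1 \<cdot>\<^sub>m M ?z) = M ?z" by (intro eq_matI) auto
  ultimately have "poly (char_poly (M ?z)) ?x = 0" by (simp add: eigenvalue_root_char_poly[OF carrier(3)])
  moreover have "dist (c j) ?x < d / 2"
  proof -
    \<comment> \<open>The centre is imaginary, hence fixed by the reflection x -> - cnj x, which is
      an isometry.\<close>
    have "c j - ?x = - cnj (c j - \<mu> j ?z)" by (simp add: c_def)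
    then have "dist (c j) ?x = dist (c j) (\<mu> j ?z)" unfolding dist_norm by (simp only: norm_minus_cancel complex_mod_cnj)
    then show ?thesis using \<mu>_ball[OF j z] by simp
  qed
  ultimately have "?x = \<mu> j ?z" using \<mu>_unique[OF j z] by blast
  from arg_cong[OF this, of Re] show ?thesis by simp
qed

section \<open>Return to A(beta) and the family zeta_j\<close>

definition A :: "complex \<Rightarrow> complex mat" where "A \<beta> = \<Omega> - (\<i> * \<beta>) \<cdot>\<^sub>m B"

definition \<zeta> :: "nat \<Rightarrow> complex \<Rightarrow> complex" where "\<zeta> j \<beta> = \<beta> * \<mu> j (inverse \<beta>)"

text \<open>For beta \<noteq> 0, A(beta) is a nonzero multiple of M(1/beta), so the eigenprojections
  of the two matrices coincide.\<close>

definition P :: "nat \<Rightarrow> complex \<Rightarrow> complex mat" where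
  "P j \<beta> = eigenproj (M (inverse \<beta>)) (\<mu> j (inverse \<beta>))"

lemma A_eq: "\<beta> \<noteq> 0 \<Longrightarrow> A \<beta> = \<beta> \<cdot>\<^sub>m M (inverse \<beta>)"
  using carrier by (intro eq_matI) (auto simp: A_def M_def algebra_simps)

lemma A_carrier: "A \<beta> \<in> carrier_mat n n"
  using carrier by (auto simp: A_def)

lemma \<zeta>_root: "j \<in> {1..m} \<Longrightarrow> \<beta> \<noteq> 0 \<Longrightarrow> inverse \<beta> \<in> U \<Longrightarrow> poly (char_poly (A \<beta>)) (\<zeta> j \<beta>) = 0"
  and \<zeta>_simple: "j \<in> {1..m} \<Longrightarrow> \<beta> \<noteq> 0 \<Longrightarrow> inverse \<beta> \<in> U \<Longrightarrow> poly (pderiv (char_poly (A \<beta>))) (\<zeta> j \<beta>) \<noteq> 0"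
  using char_poly_smult_mat[OF carrier(3), of \<beta> "inverse \<beta>" "\<mu> j (inverse \<beta>)"]
    pderiv_char_poly_smult_mat[OF carrier(3), of \<beta> "inverse \<beta>" "\<mu> j (inverse \<beta>)"]
    \<mu>_root[of j "inverse \<beta>"] \<mu>_simple[of j "inverse \<beta>"]
  by (auto simp: A_eq \<zeta>_def)

lemma A_root_scaled:
  "\<beta> \<noteq> 0 \<Longrightarrow> poly (char_poly (A \<beta>)) x = 0 \<Longrightarrow> poly (char_poly (M (inverse \<beta>))) (x / \<beta>) = 0"
  using char_poly_smult_mat[OF carrier(3), of \<beta> "inverse \<beta>" "x / \<beta>"] by (simp add: A_eq)

lemma P_props:
  assumes j: "j \<in> {1..m}" and \<beta>: "\<beta> \<noteq> 0" "inverse \<beta> \<in> U"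
  shows "is_eigenprojection (A \<beta>) (\<zeta> j \<beta>) (P j \<beta>)" "vec_space.rank n (P j \<beta>) = 1"
proof -
  let ?z = "inverse \<beta>" and ?\<nu> = "\<mu> j (inverse \<beta>)"
  note sp = simple_root_eigenproj[OF carrier(3) \<mu>_root[OF j \<beta>(2)] \<mu>_simple[OF j \<beta>(2)], folded P_def]
  show "vec_space.rank n (P j \<beta>) = 1" by (rule sp)
  have Mz: "M ?z \<in> carrier_mat n n" by (rule carrier)
  show "is_eigenprojection (A \<beta>) (\<zeta> j \<beta>) (P j \<beta>)"
  proof (rule is_eigenprojectionI[OF A_carrier sp(1)])
    show "A \<beta> * P j \<beta> = \<zeta> j \<beta> \<cdot>\<^sub>m P j \<beta>"
      using mult_smult_assoc_mat[OF Mz sp(1), of \<beta>] sp(2)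
      by (simp add: A_eq[OF \<beta>(1)] \<zeta>_def) (intro eq_matI; simp)
    show "P j \<beta> * A \<beta> = \<zeta> j \<beta> \<cdot>\<^sub>m P j \<beta>"
      using mult_smult_distrib[OF sp(1) Mz, of \<beta>] sp(3)
      by (simp add: A_eq[OF \<beta>(1)] \<zeta>_def) (intro eq_matI; simp)
    fix v :: "complex vec" assume v: "v \<in> carrier_vec n" "A \<beta> *\<^sub>v v = \<zeta> j \<beta> \<cdot>\<^sub>v v"
    then have "\<beta> \<cdot>\<^sub>v (M ?z *\<^sub>v v) = \<beta> \<cdot>\<^sub>v (?\<nu> \<cdot>\<^sub>v v)"
      using smult_mat_mult_vec[OF Mz v(1), of \<beta>] by (simp add: A_eq[OF \<beta>(1)] \<zeta>_def smult_smult_assoc)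
    then have "inverse \<beta> \<cdot>\<^sub>v (\<beta> \<cdot>\<^sub>v (M ?z *\<^sub>v v)) = inverse \<beta> \<cdot>\<^sub>v (\<beta> \<cdot>\<^sub>v (?\<nu> \<cdot>\<^sub>v v))" by simp
    then have "M ?z *\<^sub>v v = ?\<nu> \<cdot>\<^sub>v v" using \<beta>(1) by (simp add: smult_smult_assoc mult.assoc[symmetric])
    then show "P j \<beta> *\<^sub>v v = v" by (rule sp(4)[OF v(1)])
  qed
qed

text \<open>Simplicity of the root keeps the denominator chi' nonzero, and all other ingredients are
  polynomial in z and mu_j(z). The point z = 0 is included, so the projection extends analytically
  across it.\<close>

lemma eigenproj_analytic:
  assumes j: "j \<in> {1..m}" and kl: "k < n" "l < n"
  shows "(\<lambda>z. eigenproj (M z) (\<mu> j z) $$ (k, l)) analytic_on U"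
proof -
  note hol = \<mu>_holomorphic[OF j]
  have poly_hol: "(\<lambda>z. poly p z) holomorphic_on U" for p :: "complex poly"
    unfolding poly_altdef by (intro holomorphic_intros)
  have 1: "(\<lambda>z. poly (pderiv (char_poly (M z))) (\<mu> j z)) holomorphic_on U"
    unfolding specialize_C[symmetric] pderiv_specialize poly_specialize
    by (intro holomorphic_intros hol poly_hol)
  have X: "- char_matrix (M z) (\<mu> j z) \<in> carrier_mat n n" for z using carrier(3) by simp
  have 2: "(\<lambda>z. adj_mat (- char_matrix (M z) (\<mu> j z)) $$ (k, l)) holomorphic_on U"
  proof (rule adj_mat_holomorphic[OF X _ kl])
    fix i i' assume ii: "i < n" "i' < n"
    have "(\<lambda>z. - (z * \<Omega> $$ (i, i') - \<i> * B $$ (i, i') + (- \<mu> j z) * (if i = i' then 1 else 0))) holomorphic_on U"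
      by (intro holomorphic_intros hol)
    moreover have "(- char_matrix (M z) (\<mu> j z)) $$ (i, i') =
        - (z * \<Omega> $$ (i, i') - \<i> * B $$ (i, i') + (- \<mu> j z) * (if i = i' then 1 else 0))" for z
      using ii carrier carrier(3)[of z] by (simp add: char_matrix_def M_def)
    ultimately show "(\<lambda>z. (- char_matrix (M z) (\<mu> j z)) $$ (i, i')) holomorphic_on U" by simp
  qed
  have "(\<lambda>z. inverse (poly (pderiv (char_poly (M z))) (\<mu> j z)) *
      adj_mat (- char_matrix (M z) (\<mu> j z)) $$ (k, l)) holomorphic_on U"
    by (intro holomorphic_intros 1 2) (use \<mu>_simple[OF j] in auto)
  moreover have "eigenproj (M z) (\<mu> j z) $$ (k, l) = inverse (poly (pderiv (char_poly (M z))) (\<mu> j z)) *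
      adj_mat (- char_matrix (M z) (\<mu> j z)) $$ (k, l)" for z
    using adj_mat(1)[OF X, of z] kl by (simp add: eigenproj_def)
  ultimately show ?thesis by (simp add: analytic_on_open[OF open_U])
qed

text \<open>Since zeta_j(1/z) = mu_j(z) / z, the Laurent series is the Taylor series of mu_j shifted
  by one index and inherits its radius of convergence.\<close>

lemma \<zeta>_laurent:
  assumes j: "j \<in> {1..m}"
  obtains F where "(\<lambda>z. \<zeta> j (inverse z)) has_laurent_expansion F"
    "inverse (ereal (2 * \<omega> / d)) \<le> fls_conv_radius F" "0 < fls_conv_radius F"
    "\<And>z. z \<in> U - {0} \<Longrightarrow> \<zeta> j (inverse z) = eval_fls F z"
proof -
  let ?r = "inverse (ereal (2 * \<omega> / d))"
  define f where "f = fps_expansion (\<mu> j) 0"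
  define F where "F = fls_shift 1 (fps_to_fls f)"
  have hol: "\<mu> j holomorphic_on eball 0 ?r" using \<mu>_holomorphic[OF j] by (simp add: U_def)
  have rad: "?r \<le> fls_conv_radius F"
    using conv_radius_fps_expansion[OF hol] by (simp add: F_def f_def)
  have r0: "0 < ?r" using zero_in_U by (simp add: U_def zero_ereal_def)
  have ev: "\<zeta> j (inverse z) = eval_fls F z" if z: "z \<in> U - {0}" for z
  proof -
    have "z \<in> eball 0 ?r" "z \<noteq> 0" using z by (auto simp: U_def)
    moreover have "ereal (norm z) < fps_conv_radius f"
      using calculation conv_radius_fps_expansion[OF hol] by (auto simp: f_def in_eball_iff intro: less_le_trans)
    moreover have "eval_fps f z = \<mu> j z"
      using eval_fps_expansion[OF hol, of z] calculation by (simp add: f_def)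
    ultimately show ?thesis
      by (simp add: F_def eval_fls_shift eval_fps_to_fls \<zeta>_def field_simps)
  qed
  have "eventually (\<lambda>z. eval_fls F z = \<zeta> j (inverse z)) (at 0)"
    using eventually_at_in_open[OF open_U zero_in_U] by eventually_elim (use ev in simp)
  then have "(\<lambda>z. \<zeta> j (inverse z)) has_laurent_expansion F"
    using rad r0 by (auto simp: has_laurent_expansion_def)
  then show thesis using that rad r0 ev less_le_trans by blast
qed

lemma inverse_in_U:
  assumes "2 * \<omega> / d < \<beta>"
  shows "complex_of_real (inverse \<beta>) \<in> U"
proof -
  have "0 < \<beta>" using assms \<omega>(2) gap_pos by (smt (verit) divide_nonneg_pos)
  then have "cmod (complex_of_real (inverse \<beta>)) * \<omega> = \<omega> / \<beta>"
    unfolding norm_of_real by (simp add: divide_inverse mult.commute)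
  moreover have "\<omega> / \<beta> < d / 2" using assms \<open>0 < \<beta>\<close> gap_pos by (simp add: field_simps)
  ultimately show ?thesis unfolding in_U_iff by simp
qed

lemma eventually_in_U: "\<forall>\<^sub>F \<beta> in at_top. 0 < \<beta> \<and> inverse (complex_of_real \<beta>) \<in> U"
proof -
  have "\<forall>\<^sub>F \<beta> in at_top. max 0 (2 * \<omega> / d) < (\<beta> :: real)" by (rule eventually_gt_at_top)
  then show ?thesis
  proof eventually_elim
    case (elim \<beta>)
    then show ?case using inverse_in_U[of \<beta>] by simp
  qed
qed

lemma \<zeta>_asymptotic:
  assumes j: "j \<in> {1..m}" and \<beta>: "0 < \<beta>" "inverse (complex_of_real \<beta>) \<in> U"
  shows "cmod (\<zeta> j (of_real \<beta>) - (- \<i> * of_real (b j) * of_real \<beta>)) \<le> \<omega>"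
proof -
  have "\<zeta> j (of_real \<beta>) - (- \<i> * of_real (b j) * of_real \<beta>) = of_real \<beta> * (\<mu> j (inverse (of_real \<beta>)) - c j)"
    by (simp add: \<zeta>_def c_def algebra_simps)
  then have "cmod (\<zeta> j (of_real \<beta>) - (- \<i> * of_real (b j) * of_real \<beta>)) = \<beta> * dist (c j) (\<mu> j (inverse (of_real \<beta>)))"
    using \<beta>(1) by (simp only: norm_mult dist_norm norm_minus_commute) simp
  also have "\<dots> \<le> \<beta> * (cmod (inverse (of_real \<beta>)) * \<omega>)"
    using \<mu>_near[OF j \<beta>(2)] \<beta>(1) by (intro mult_left_mono) auto
  also have "\<dots> = \<omega>" using \<beta>(1) by (simp add: norm_inverse)
  finally show ?thesis .
qed

text \<open>After the m simple factors are split off, a remaining root x has x / beta near some c_k.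
  For k >= 1 it would coincide with mu_k, and zeta_k would be a double root; hence k = 0, and x /
  beta lies within \<omega> / beta of 0.\<close>

lemma char_poly_A_split:
  assumes \<beta>: "0 < \<beta>" "inverse (complex_of_real \<beta>) \<in> U"
  shows "\<exists>\<mu>s. char_poly (A (of_real \<beta>)) = (\<Prod>j=1..m. [:- \<zeta> j (of_real \<beta>), 1:]) * (\<Prod>\<mu>\<leftarrow>\<mu>s. [:- \<mu>, 1:]) \<and>
           (\<forall>\<mu>\<in>set \<mu>s. cmod \<mu> \<le> \<omega>)"
proof -
  let ?\<beta> = "complex_of_real \<beta>" and ?z = "inverse (complex_of_real \<beta>)"
  let ?p = "char_poly (A ?\<beta>)" and ?L = "\<Prod>j=1..m. [:- \<zeta> j ?\<beta>, 1:]"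
  have \<beta>0: "?\<beta> \<noteq> 0" using \<beta>(1) by simp
  have "inj_on (\<lambda>j. \<zeta> j ?\<beta>) {1..m}"
  proof (rule inj_onI)
    fix i j assume "i \<in> {1..m}" "j \<in> {1..m}" "\<zeta> i ?\<beta> = \<zeta> j ?\<beta>"
    then show "i = j" using inj_onD[OF \<mu>_inj[OF \<beta>(2)], of i j] \<beta>0 by (simp add: \<zeta>_def)
  qed
  then have "?L dvd ?p" using \<zeta>_root[OF _ \<beta>0 \<beta>(2)] by (intro prod_linear_dvd) auto
  then obtain q where q: "?p = ?L * q" by (auto simp: dvd_def)
  have "monic ?L" by (intro monic_prod) auto
  moreover have "monic ?p" using degree_monic_char_poly[OF A_carrier] by simp
  ultimately have "monic q" using lead_coeff_mult[of ?L q] unfolding q by simp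
  then obtain \<mu>s where \<mu>s: "q = (\<Prod>\<mu>\<leftarrow>\<mu>s. [:- \<mu>, 1:])" by (rule monic_complex_poly_factorized)
  have "cmod x \<le> \<omega>" if x: "x \<in> set \<mu>s" for x
  proof -
    have qx: "poly q x = 0" using x by (simp add: \<mu>s poly_prod_linear_eq_0_iff)
    then have "poly ?p x = 0" by (simp add: q)
    from root_near_c[OF A_root_scaled[OF \<beta>0 this]] obtain k where
      k: "k \<le> m" "dist (c k) (x / ?\<beta>) \<le> cmod ?z * \<omega>" .
    have "k = 0"
    proof (rule ccontr)
      assume "k \<noteq> 0"
      then have k': "k \<in> {1..m}" using k by auto
      have "dist (c k) (x / ?\<beta>) < d / 2" using k(2) \<beta>(2) by (simp add: in_U_iff)
      then have "x / ?\<beta> = \<mu> k ?z"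
        using \<mu>_unique[OF k' \<beta>(2)] A_root_scaled[OF \<beta>0 \<open>poly ?p x = 0\<close>] by blast
      then have xk: "x = \<zeta> k ?\<beta>" using \<beta>0 by (simp add: \<zeta>_def field_simps)
      have "?L = [:- \<zeta> k ?\<beta>, 1:] * (\<Prod>j\<in>{1..m} - {k}. [:- \<zeta> j ?\<beta>, 1:])"
        using k' by (intro prod.remove) auto
      then have "?p = [:- \<zeta> k ?\<beta>, 1:] * ((\<Prod>j\<in>{1..m} - {k}. [:- \<zeta> j ?\<beta>, 1:]) * q)"
        unfolding q by (simp only: mult.assoc)
      then have "poly (pderiv ?p) (\<zeta> k ?\<beta>) = 0"
        using qx xk by (simp only: poly_pderiv_linear_mult) simp
      then show False using \<zeta>_simple[OF k' \<beta>0 \<beta>(2)] by blast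
    qed
    moreover have "c 0 = 0" by (simp add: c_def b_0)
    ultimately have "cmod (x / ?\<beta>) \<le> cmod ?z * \<omega>" using k(2) by simp
    also have "\<dots> = \<omega> / \<beta>" using \<beta>(1) by (simp add: norm_inverse divide_inverse mult.commute)
    finally have "cmod x / \<beta> \<le> \<omega> / \<beta>" using \<beta>(1) by (simp add: norm_divide)
    then show ?thesis using \<beta>(1) by (simp add: divide_le_cancel)
  qed
  then show ?thesis using q \<mu>s by auto
qed

lemma high_loss_\<zeta>: "high_loss_eigenvalues A m b (\<lambda>j \<beta>. \<zeta> j (complex_of_real \<beta>))"
  unfolding high_loss_eigenvalues_def
proof (intro conjI ballI)
  show "\<exists>K. \<forall>\<^sub>F \<beta> in at_top. \<exists>\<mu>s.
        char_poly (A (complex_of_real \<beta>)) = (\<Prod>j=1..m. [:- \<zeta> j (complex_of_real \<beta>), 1:]) * (\<Prod>\<mu>\<leftarrow>\<mu>s. [:- \<mu>, 1:]) \<and>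
        (\<forall>\<mu>\<in>set \<mu>s. cmod \<mu> \<le> K)"
    by (rule exI[of _ \<omega>], rule eventually_mono[OF eventually_in_U], rule char_poly_A_split) simp_all
  fix j assume j: "j \<in> {1..m}"
  obtain F where F: "0 < fls_conv_radius F" "\<And>z. z \<in> U - {0} \<Longrightarrow> \<zeta> j (inverse z) = eval_fls F z"
    using \<zeta>_laurent[OF j] by metis
  have "\<forall>\<^sub>F \<beta> in at_top. \<zeta> j (complex_of_real \<beta>) = eval_fls F (inverse (complex_of_real \<beta>))"
    using eventually_in_U
  proof eventually_elim
    case (elim \<beta>)
    then show ?case using F(2)[of "inverse (complex_of_real \<beta>)"] by simp
  qed
  then show "\<exists>F. fls_conv_radius F > 0 \<and>
      (\<forall>\<^sub>F \<beta> in at_top. \<zeta> j (complex_of_real \<beta>) = eval_fls F (inverse (complex_of_real \<beta>)))"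
    using F(1) by blast
  show "(\<lambda>\<beta>. \<zeta> j (complex_of_real \<beta>) - (- \<i> * complex_of_real (b j) * complex_of_real \<beta>)) \<in> O[at_top](\<lambda>_. 1)"
    using eventually_mono[OF eventually_in_U] \<zeta>_asymptotic[OF j]
    by (intro bigoI[of _ \<omega>]) (auto elim!: eventually_mono)
qed

text \<open>The O(1) condition places zeta'_j / beta within K / beta of c_j, which is inside the
  disc of radius d / 2 once beta > 2 K / d; the root in that disc is unique.\<close>

lemma high_loss_unique:
  assumes hl: "high_loss_eigenvalues A m b \<zeta>'" and j: "j \<in> {1..m}"
  shows "\<forall>\<^sub>F \<beta> in at_top. \<zeta>' j \<beta> = \<zeta> j (complex_of_real \<beta>)"
proof -
  have "(\<lambda>\<beta>. \<zeta>' j \<beta> - (- \<i> * complex_of_real (b j) * complex_of_real \<beta>)) \<in> O[at_top](\<lambda>_. 1)"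
    using hl j by (auto simp: high_loss_eigenvalues_def)
  then obtain K where K: "\<forall>\<^sub>F \<beta> in at_top. cmod (\<zeta>' j \<beta> - (- \<i> * complex_of_real (b j) * complex_of_real \<beta>)) \<le> K"
    by (auto elim!: landau_o.bigE)
  obtain K' where K': "\<forall>\<^sub>F \<beta> in at_top. \<exists>\<mu>s.
        char_poly (A (complex_of_real \<beta>)) = (\<Prod>j=1..m. [:- \<zeta>' j \<beta>, 1:]) * (\<Prod>\<mu>\<leftarrow>\<mu>s. [:- \<mu>, 1:]) \<and>
        (\<forall>\<mu>\<in>set \<mu>s. cmod \<mu> \<le> K')"
    using hl unfolding high_loss_eigenvalues_def by blast
  have "\<forall>\<^sub>F \<beta> in at_top. 2 * K / d < \<beta>" by (rule eventually_gt_at_top)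
  with K K' eventually_in_U show ?thesis
  proof eventually_elim
    case (elim \<beta>)
    let ?\<beta> = "complex_of_real \<beta>"
    have \<beta>: "0 < \<beta>" "?\<beta> \<noteq> 0" "inverse ?\<beta> \<in> U" using elim by auto
    obtain \<mu>s where "char_poly (A ?\<beta>) = (\<Prod>j=1..m. [:- \<zeta>' j \<beta>, 1:]) * (\<Prod>\<mu>\<leftarrow>\<mu>s. [:- \<mu>, 1:])"
      using elim(2) by blast
    then have "poly (char_poly (A ?\<beta>)) (\<zeta>' j \<beta>) = 0" using j by (auto simp: poly_prod)
    then have root: "poly (char_poly (M (inverse ?\<beta>))) (\<zeta>' j \<beta> / ?\<beta>) = 0" by (rule A_root_scaled[OF \<beta>(2)])
    have "\<zeta>' j \<beta> - (- \<i> * complex_of_real (b j) * ?\<beta>) = ?\<beta> * (\<zeta>' j \<beta> / ?\<beta> - c j)"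
      using \<beta>(2) by (simp add: c_def field_simps)
    then have "\<beta> * dist (c j) (\<zeta>' j \<beta> / ?\<beta>) \<le> K"
      using elim(1) \<beta>(1) by (simp only: norm_mult dist_norm norm_minus_commute norm_of_real abs_of_pos)
    moreover have "K < \<beta> * (d / 2)" using elim(4) gap_pos by (simp add: field_simps)
    ultimately have "\<beta> * dist (c j) (\<zeta>' j \<beta> / ?\<beta>) < \<beta> * (d / 2)" by linarith
    then have "dist (c j) (\<zeta>' j \<beta> / ?\<beta>) < d / 2" using \<beta>(1) by (simp only: mult_less_cancel_left_pos)
    from \<mu>_unique[OF j \<beta>(3) this root] show ?case using \<beta>(2) by (simp add: \<zeta>_def field_simps)
  qed
qed

end

section \<open>The system operator\<close>

lemma sqrt_mat_carrier: "psd_mat N M \<Longrightarrow> sqrt_mat M \<in> carrier_mat N N"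
  using sqrt_mat(1)[of N M] by (simp add: psd_mat_def sym_mat_def)

lemma congruence_transpose:
  fixes Z :: "real mat"
  assumes "sym_mat N Z" "X \<in> carrier_mat N N"
  shows "transpose_mat (Z * X * Z) = Z * transpose_mat X * Z"
proof -
  have Z: "Z \<in> carrier_mat N N" "transpose_mat Z = Z" using assms by (auto simp: sym_mat_def)
  have "transpose_mat (Z * X * Z) = Z * transpose_mat (Z * X)"
    using Z assms(2) by (subst transpose_mult[of _ N N _ N]) auto
  also have "transpose_mat (Z * X) = transpose_mat X * Z"
    using Z assms(2) by (subst transpose_mult[of _ N N _ N]) auto
  finally show ?thesis using Z assms(2) by (simp add: assoc_mult_mat[of _ N N _ N _ N])
qed

text \<open>\<theta> is skew, so -2 i times its real symmetric congruence is Hermitian; every block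
  is i times a real matrix, which gives the second claim.\<close>

lemma Omega_mat_props:
  assumes \<alpha>: "pd_mat N \<alpha>" and \<eta>: "psd_mat N \<eta>"
    and \<theta>: "\<theta> \<in> carrier_mat N N" "transpose_mat \<theta> = - \<theta>"
  shows "hermitian_mat (2 * N) (Omega_mat \<alpha> \<eta> \<theta>)"
    and "map_mat cnj (Omega_mat \<alpha> \<eta> \<theta>) = - Omega_mat \<alpha> \<eta> \<theta>"
proof -
  let ?Z = "inv_sqrt_mat \<alpha>"
  have Z: "sym_mat N ?Z" by (rule inv_sqrt_mat_sym[OF \<alpha>])
  then have Zc: "?Z \<in> carrier_mat N N" by (simp add: sym_mat_def)
  have N: "dim_row \<alpha> = N" using \<alpha> by (auto simp: pd_mat_def sym_mat_def)
  define K where "K = ?Z * \<theta> * ?Z"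
  define F where "F = Phi_mat \<alpha> \<eta>"
  have Kc: "K \<in> carrier_mat N N" using Zc \<theta> by (simp add: K_def)
  have Fc: "F \<in> carrier_mat N N" using Zc sqrt_mat_carrier[OF \<eta>] by (simp add: F_def Phi_mat_def)
  have Kt: "transpose_mat K = - K"
    unfolding K_def congruence_transpose[OF Z \<theta>(1)] \<theta>(2) using Zc \<theta>(1) by auto
  have K: "K $$ (j, i) = - K $$ (i, j)" if "i < N" "j < N" for i j
    using arg_cong[OF Kt, of "\<lambda>X. X $$ (i, j)"] that Kc by auto
  have dims: "dim_row K = N" "dim_col K = N" "dim_row F = N" "dim_col F = N" using Kc Fc by auto
  have O: "Omega_mat \<alpha> \<eta> \<theta> = four_block_mat ((- 2 * \<i>) \<cdot>\<^sub>m cmat K) ((- \<i>) \<cdot>\<^sub>m cmat (transpose_mat F))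
      (\<i> \<cdot>\<^sub>m cmat F) (0\<^sub>m N N)"
    unfolding Omega_mat_def N K_def F_def ..
  show "hermitian_mat (2 * N) (Omega_mat \<alpha> \<eta> \<theta>)"
    unfolding hermitian_mat_def
  proof
    show "Omega_mat \<alpha> \<eta> \<theta> \<in> carrier_mat (2 * N) (2 * N)"
      unfolding O mult_2 using Kc by (intro four_block_carrier_mat) auto
    show "ctrans (Omega_mat \<alpha> \<eta> \<theta>) = Omega_mat \<alpha> \<eta> \<theta>"
    proof (rule eq_matI)
      fix i j assume "i < dim_row (Omega_mat \<alpha> \<eta> \<theta>)" "j < dim_col (Omega_mat \<alpha> \<eta> \<theta>)"
      then have ij: "i < N + N" "j < N + N" by (auto simp: O dims)
      then show "ctrans (Omega_mat \<alpha> \<eta> \<theta>) $$ (i, j) = Omega_mat \<alpha> \<eta> \<theta> $$ (i, j)"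
        using K[of i j] by (auto simp: O dims)
    qed (auto simp: O dims)
  qed
  show "map_mat cnj (Omega_mat \<alpha> \<eta> \<theta>) = - Omega_mat \<alpha> \<eta> \<theta>"
    by (rule eq_matI) (auto simp: O dims)
qed

lemma B_mat_props:
  assumes \<alpha>: "pd_mat N \<alpha>" and R: "psd_mat N R"
  shows "hermitian_mat (2 * N) (B_mat \<alpha> R)" and "map_mat cnj (B_mat \<alpha> R) = B_mat \<alpha> R"
proof -
  let ?Z = "inv_sqrt_mat \<alpha>"
  have Z: "sym_mat N ?Z" by (rule inv_sqrt_mat_sym[OF \<alpha>])
  then have Zc: "?Z \<in> carrier_mat N N" by (simp add: sym_mat_def)
  have Rc: "R \<in> carrier_mat N N" "transpose_mat R = R" using R by (auto simp: psd_mat_def sym_mat_def)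
  have N: "dim_row \<alpha> = N" using \<alpha> by (auto simp: pd_mat_def sym_mat_def)
  define K where "K = ?Z * R * ?Z"
  have Kc: "K \<in> carrier_mat N N" using Zc Rc by (simp add: K_def)
  have "sym_mat N K"
    using Kc congruence_transpose[OF Z Rc(1)] Rc(2) by (simp add: sym_mat_def K_def)
  note K = sym_mat_index[OF this]
  have dims: "dim_row K = N" "dim_col K = N" using Kc by auto
  have B: "B_mat \<alpha> R = four_block_mat (cmat K) (0\<^sub>m N N) (0\<^sub>m N N) (0\<^sub>m N N)"
    unfolding B_mat_def N K_def ..
  show "hermitian_mat (2 * N) (B_mat \<alpha> R)"
    unfolding hermitian_mat_def
  proof
    show "B_mat \<alpha> R \<in> carrier_mat (2 * N) (2 * N)"
      unfolding B mult_2 using Kc by (intro four_block_carrier_mat) auto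
    show "ctrans (B_mat \<alpha> R) = B_mat \<alpha> R"
    proof (rule eq_matI)
      fix i j assume "i < dim_row (B_mat \<alpha> R)" "j < dim_col (B_mat \<alpha> R)"
      then have ij: "i < N + N" "j < N + N" by (auto simp: B dims)
      then show "ctrans (B_mat \<alpha> R) $$ (i, j) = B_mat \<alpha> R $$ (i, j)"
        using K[of i j] by (auto simp: B dims)
    qed (auto simp: B dims)
  qed
  show "map_mat cnj (B_mat \<alpha> R) = B_mat \<alpha> R"
    by (rule eq_matI) (auto simp: B dims)
qed

lemma symmetric_spectrum:
  assumes A: "A \<in> carrier_mat n n" "map_mat cnj A = - A" and ev: "eigenvalue A (complex_of_real t)"
  shows "eigenvalue A (complex_of_real (- t))"
proof -
  have "eigenvalue (map_mat cnj A) (cnj (complex_of_real t))"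
    by (rule cnj_hom.eigenvalue_hom[OF A(1) ev])
  then have "eigenvalue (-1 \<cdot>\<^sub>m (map_mat cnj A)) (-1 * complex_of_real t)"
    using A(1) by (intro eigenvalue_smult_mat[of _ n]) auto
  moreover have "-1 \<cdot>\<^sub>m (map_mat cnj A) = A" unfolding A(2) by (intro eq_matI) auto
  ultimately show ?thesis by simp
qed

text \<open>\<open>omega_max\<close> is a maximum of signed eigenvalues; the symmetry t -> -t of the
  spectrum turns it into a bound for |t|. Finiteness of the spectrum makes \<open>Max\<close>
  meaningful.\<close>

lemma omega_max_bound:
  assumes \<Omega>: "Omega_mat \<alpha> \<eta> \<theta> \<in> carrier_mat n n" "map_mat cnj (Omega_mat \<alpha> \<eta> \<theta>) = - Omega_mat \<alpha> \<eta> \<theta>"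
    and ev: "eigenvalue (Omega_mat \<alpha> \<eta> \<theta>) (complex_of_real t)"
  shows "\<bar>t\<bar> \<le> omega_max \<alpha> \<eta> \<theta>"
proof -
  let ?S = "{t. eigenvalue (Omega_mat \<alpha> \<eta> \<theta>) (complex_of_real t)}"
  have "char_poly (Omega_mat \<alpha> \<eta> \<theta>) \<noteq> 0" using degree_monic_char_poly[OF \<Omega>(1)] by auto
  then have "finite {x. poly (char_poly (Omega_mat \<alpha> \<eta> \<theta>)) x = 0}" by (rule poly_roots_finite)
  then have "finite (complex_of_real -` {x. poly (char_poly (Omega_mat \<alpha> \<eta> \<theta>)) x = 0})"
    by (intro finite_vimageI) (auto simp: inj_on_def)
  then have fin: "finite ?S" by (simp add: eigenvalue_root_char_poly[OF \<Omega>(1)] vimage_def)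
  have "t \<le> omega_max \<alpha> \<eta> \<theta>" "- t \<le> omega_max \<alpha> \<eta> \<theta>"
    unfolding omega_max_def using ev symmetric_spectrum[OF \<Omega> ev] by (auto intro!: Max_ge[OF fin])
  then show ?thesis by linarith
qed

text \<open>The first two conjuncts identify the family: \<open>\<zeta>\<close> meets the definition
  of high-loss eigenvalues, and any family that meets it agrees with \<open>\<zeta>\<close> for
  large real beta. The later conjuncts therefore concern the high-loss eigenvalues themselves,
  continued to the punctured disc; order 1 expresses simplicity and rank 1 the dimension of the
  range.\<close>

theorem theorem43:
  fixes N N\<^sub>R :: nat and \<alpha> \<eta> \<theta> R :: "real mat" and b :: "nat \<Rightarrow> real"
  assumes "N \<ge> 1"
    and "pd_mat N \<alpha>"
    and "psd_mat N \<eta>"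
    and "\<theta> \<in> carrier_mat N N" "transpose_mat \<theta> = - \<theta>"
    and "psd_mat N R"
    and "N\<^sub>R = vec_space.rank N R" "N\<^sub>R > 0"
    and "nonzero_eigenvalues (B_mat \<alpha> R) N\<^sub>R b"
    and "inj_on b {1..N\<^sub>R}"
  shows "\<exists>(\<zeta> :: nat \<Rightarrow> complex \<Rightarrow> complex) (P :: nat \<Rightarrow> complex \<Rightarrow> complex mat).
    high_loss_eigenvalues (system_op \<alpha> \<eta> \<theta> R) N\<^sub>R b (\<lambda>j \<beta>. \<zeta> j (complex_of_real \<beta>)) \<and>
    (\<forall>\<zeta>'. high_loss_eigenvalues (system_op \<alpha> \<eta> \<theta> R) N\<^sub>R b \<zeta>' \<longrightarrow>
       (\<forall>j\<in>{1..N\<^sub>R}. \<forall>\<^sub>F \<beta> in at_top. \<zeta>' j \<beta> = \<zeta> j (complex_of_real \<beta>))) \<and>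
    (\<forall>j\<in>{1..N\<^sub>R}.
       (\<exists>F. (\<lambda>z. \<zeta> j (inverse z)) has_laurent_expansion F \<and>
            inverse (ereal (beta0 \<alpha> \<eta> \<theta> N\<^sub>R b)) \<le> fls_conv_radius F \<and>
            (\<forall>z\<in>eball 0 (inverse (ereal (beta0 \<alpha> \<eta> \<theta> N\<^sub>R b))) - {0}.
               \<zeta> j (inverse z) = eval_fls F z)) \<and>
       (\<forall>k<2*N. \<forall>l<2*N. \<exists>g.
            g analytic_on eball 0 (inverse (ereal (beta0 \<alpha> \<eta> \<theta> N\<^sub>R b))) \<and>
            (\<forall>z\<in>eball 0 (inverse (ereal (beta0 \<alpha> \<eta> \<theta> N\<^sub>R b))) - {0}.
               P j (inverse z) $$ (k, l) = g z)) \<and>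
       (\<forall>z\<in>eball 0 (inverse (ereal (beta0 \<alpha> \<eta> \<theta> N\<^sub>R b))) - {0}.
            let A = system_op \<alpha> \<eta> \<theta> R (inverse z); \<nu> = \<zeta> j (inverse z); Q = P j (inverse z)
            in eigenvalue A \<nu> \<and> Polynomial.order \<nu> (char_poly A) = 1 \<and>
               is_eigenprojection A \<nu> Q \<and> vec_space.rank (2*N) Q = 1) \<and>
       (\<forall>\<beta>>beta0 \<alpha> \<eta> \<theta> N\<^sub>R b. Re (\<zeta> j (complex_of_real \<beta>)) = 0))"
proof -
  let ?\<Omega> = "Omega_mat \<alpha> \<eta> \<theta>" and ?B = "B_mat \<alpha> R" and ?\<omega> = "omega_max \<alpha> \<eta> \<theta>"
  note \<Omega> = Omega_mat_props[OF assms(2-5)]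
  have Oc: "?\<Omega> \<in> carrier_mat (2 * N) (2 * N)" using \<Omega>(1) by (simp add: hermitian_mat_def)
  note bound = omega_max_bound[OF Oc \<Omega>(2)]
  \<comment> \<open>N \<ge> 1 supplies an eigenvalue t, and |t| \<le> \<omega> then yields \<omega>
    \<ge> 0.\<close>
  obtain t where "eigenvalue ?\<Omega> (complex_of_real t)"
    using hermitian_mat_sq_norm_expansion[OF \<Omega>(1)] assms(1)
    by (metis le_zero_eq mult_is_0 not_gr_zero zero_neq_numeral zero_neq_one)
  then have "0 \<le> ?\<omega>" using bound abs_ge_zero order_trans by blast
  then interpret pencil "2 * N" N\<^sub>R ?\<Omega> ?B ?\<omega> b
    using \<Omega> B_mat_props[OF assms(2,6)] bound assms(8-10) by unfold_locales auto
  have A: "A = system_op \<alpha> \<eta> \<theta> R" by (rule ext) (simp add: A_def system_op_def)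
  have U: "U = eball 0 (inverse (ereal (beta0 \<alpha> \<eta> \<theta> N\<^sub>R b)))" by (simp add: U_def beta0_def)
  show ?thesis
    unfolding U[symmetric] A[symmetric]
  proof (rule exI[of _ \<zeta>], rule exI[of _ P], intro conjI allI impI ballI)
    show "high_loss_eigenvalues A N\<^sub>R b (\<lambda>j \<beta>. \<zeta> j (complex_of_real \<beta>))" by (rule high_loss_\<zeta>)
    show "\<forall>\<^sub>F \<beta> in at_top. \<zeta>' j \<beta> = \<zeta> j (complex_of_real \<beta>)"
      if "high_loss_eigenvalues A N\<^sub>R b \<zeta>'" "j \<in> {1..N\<^sub>R}" for \<zeta>' j
      using that by (rule high_loss_unique)
    fix j assume j: "j \<in> {1..N\<^sub>R}"
    obtain F where F: "(\<lambda>z. \<zeta> j (inverse z)) has_laurent_expansion F"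
      "inverse (ereal (2 * ?\<omega> / d)) \<le> fls_conv_radius F"
      "\<And>z. z \<in> U - {0} \<Longrightarrow> \<zeta> j (inverse z) = eval_fls F z"
      using \<zeta>_laurent[OF j] by metis
    show "\<exists>F. (\<lambda>z. \<zeta> j (inverse z)) has_laurent_expansion F \<and>
        inverse (ereal (beta0 \<alpha> \<eta> \<theta> N\<^sub>R b)) \<le> fls_conv_radius F \<and>
        (\<forall>z\<in>U - {0}. \<zeta> j (inverse z) = eval_fls F z)"
      using F unfolding beta0_def by blast
    show "\<exists>g. g analytic_on U \<and> (\<forall>z\<in>U - {0}. P j (inverse z) $$ (k, l) = g z)"
      if "k < 2 * N" "l < 2 * N" for k l
      using eigenproj_analytic[OF j that] by (intro exI[of _ "\<lambda>z. eigenproj (M z) (\<mu> j z) $$ (k, l)"]) (simp add: P_def)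
    show "let A = A (inverse z); \<nu> = \<zeta> j (inverse z); Q = P j (inverse z)
        in eigenvalue A \<nu> \<and> Polynomial.order \<nu> (char_poly A) = 1 \<and>
           is_eigenprojection A \<nu> Q \<and> vec_space.rank (2 * N) Q = 1" if z: "z \<in> U - {0}" for z
    proof -
      have z': "inverse z \<noteq> 0" "inverse (inverse z) \<in> U" using z by auto
      show ?thesis
        unfolding Let_def
        using \<zeta>_root[OF j z'] order_eq_1_if_simple_root[OF \<zeta>_root[OF j z'] \<zeta>_simple[OF j z']] P_props[OF j z']
        by (auto simp: eigenvalue_root_char_poly[OF A_carrier])
    qed
    show "Re (\<zeta> j (complex_of_real \<beta>)) = 0" if "\<beta> > beta0 \<alpha> \<eta> \<theta> N\<^sub>R b" for \<beta>
    proof -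
      have "complex_of_real (inverse \<beta>) \<in> U"
        using that unfolding beta0_def by (intro inverse_in_U) simp
      then show ?thesis using \<mu>_imaginary[OF j, of "inverse \<beta>"] by (simp add: \<zeta>_def)
    qed
  qed
qed

end
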